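(* Let $n\ge1$, let $h:V\to\mathbb{R}$ be a smooth homogeneous function of degree $k\neq0$ defined on some open set $V\subset\mathbb{R}^{n+1}$, and let $U\subset V$ be an open subset such that $\overline{\mathcal{H}}\subset V$, where $\mathcal{H}:=\{x\in U\mid h(x)=1\}$ and the closure is taken in $\mathbb{R}^{n+1}$. Assume that the centroaffine metric $g$ of the hypersurface $\mathcal{H}\subset\mathbb{R}^{n+1}$ is definite. Then the following hold for every connected component $\mathcal{H}_0$ of $\mathcal{H}$. (i) If $(\mathcal{H}_0,g)$ is complete, then $\mathcal{H}_0\subset\mathbb{R}^{n+1}$ is a closed subset. (ii) $\mathcal{H}_0\subset\mathbb{R}^{n+1}$ is a closed subset if and only if $\mathcal{H}_0\subset\mathbb{R}^{n+1}$ is Euclidean complete.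
   Context: A smooth function $h$ on an open set is homogeneous of degree $k\in\mathbb{R}\setminus\{0\}$ if $\sum_ix^i\partial_ih=kh$. Then $\mathcal{H}=\{x\in U\mid h(x)=1\}$ is a smooth hypersurface transversal to the position vector field $\xi$. Its centroaffine metric $g$ is the symmetric tensor field determined by $\tilde\nabla_XY=\nabla_XY+g(X,Y)\xi$ for $X,Y$ tangent to $\mathcal{H}$, with $\nabla_XY$ tangent to $\mathcal{H}$ and $\tilde\nabla$ the canonical flat connection of $\mathbb{R}^{n+1}$; one has $g=-\frac1k\iota^*(\tilde\nabla^2h)$ with $\iota$ the inclusion. When $g$ is negative definite, completeness refers to the Riemannian metric $-g$. A submanifold of Euclidean space is Euclidean complete if it is complete with respect to the Riemannian metric induced by the Euclidean scalar product. *)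

theory Defs
  imports "HOL-Analysis.Analysis"
begin

text \<open>\<open>C\<^sup>k\<close> on an open set of a finite-dimensional space: continuity of all iterated
  directional derivatives up to order \<open>k\<close>. The functions are total, but on an open set \<open>S\<close> only
  the values on \<open>S\<close> matter.\<close>

primrec Ck_on ::
    "nat \<Rightarrow> ('a::euclidean_space \<Rightarrow> 'b::real_normed_vector) \<Rightarrow> 'a set \<Rightarrow> bool" where
  "Ck_on 0 f S \<longleftrightarrow> continuous_on S f"
| "Ck_on (Suc k) f S \<longleftrightarrow>
     (\<forall>x\<in>S. f differentiable (at x)) \<and>
     (\<forall>v. Ck_on k (\<lambda>x. frechet_derivative f (at x) v) S)"

definition smooth_on ::
    "('a::euclidean_space \<Rightarrow> 'b::real_normed_vector) \<Rightarrow> 'a set \<Rightarrow> bool" where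
  "smooth_on f S \<longleftrightarrow> (\<forall>k. Ck_on k f S)"

definition homogeneous_on :: "(real ^ 'm \<Rightarrow> real) \<Rightarrow> real \<Rightarrow> (real ^ 'm) set \<Rightarrow> bool" where
  "homogeneous_on h k V \<longleftrightarrow>
     (\<forall>x\<in>V. (\<Sum>i\<in>UNIV. x $ i * frechet_derivative h (at x) (axis i 1)) = k * h x)"

text \<open>The tangent space of an embedded submanifold \<open>M\<close> at \<open>p\<close>, as the set of velocities at \<open>p\<close>
  of smooth curves in \<open>M\<close>.\<close>

definition tangent_space :: "'a::euclidean_space set \<Rightarrow> 'a \<Rightarrow> 'a set" where
  "tangent_space M p =
     {v. \<exists>c e. e > 0 \<and> smooth_on c {-e<..<e::real} \<and> c ` {-e<..<e} \<subseteq> M \<and> c 0 = p \<and>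
           (c has_vector_derivative v) (at 0)}"

text \<open>A tensor field of type \<open>(0,2)\<close> on \<open>M\<close> is a function \<open>g p u v\<close>, of which only the values at
  \<open>p \<in> M\<close> and \<open>u, v \<in> tangent_space M p\<close> are meaningful.\<close>

type_synonym 'a tensor2 = "'a \<Rightarrow> 'a \<Rightarrow> 'a \<Rightarrow> real"

text \<open>The centroaffine metric of a hypersurface \<open>M\<close> transversal to the position vector field, by
  the Gauss formula: \<open>g p u v\<close> is the number \<open>c\<close> for which the flat derivative at \<open>p\<close> in
  direction \<open>u\<close> of any tangent vector field \<open>Y\<close> with \<open>Y p = v\<close> differs from \<open>c *\<^sub>R p\<close> by a tangent
  vector. Smooth vector fields along \<open>M\<close> near \<open>p\<close> are given by smooth extensions \<open>Y\<close> to an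
  ambient neighbourhood \<open>W\<close> of \<open>p\<close>.\<close>

definition centroaffine_metric :: "'a::euclidean_space set \<Rightarrow> 'a tensor2" where
  "centroaffine_metric M p u v =
     (THE c. \<forall>Y W. open W \<and> p \<in> W \<and> smooth_on Y W \<and>
               (\<forall>q\<in>M \<inter> W. Y q \<in> tangent_space M q) \<and> Y p = v \<longrightarrow>
               frechet_derivative Y (at p) u - c *\<^sub>R p \<in> tangent_space M p)"

definition pos_definite_at :: "'a::euclidean_space set \<Rightarrow> 'a tensor2 \<Rightarrow> 'a \<Rightarrow> bool" where
  "pos_definite_at M g p \<longleftrightarrow> (\<forall>v\<in>tangent_space M p. v \<noteq> 0 \<longrightarrow> g p v v > 0)"

definition neg_definite_at :: "'a::euclidean_space set \<Rightarrow> 'a tensor2 \<Rightarrow> 'a \<Rightarrow> bool" where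
  "neg_definite_at M g p \<longleftrightarrow> (\<forall>v\<in>tangent_space M p. v \<noteq> 0 \<longrightarrow> g p v v < 0)"

definition definite_on :: "'a::euclidean_space set \<Rightarrow> 'a tensor2 \<Rightarrow> bool" where
  "definite_on M g \<longleftrightarrow> (\<forall>p\<in>M. pos_definite_at M g p \<or> neg_definite_at M g p)"

text \<open>The Riemannian distance, intended for connected \<open>M\<close> and positive definite \<open>g\<close>: the infimum
  of the lengths of piecewise \<open>C\<^sup>1\<close> curves in \<open>M\<close>. Since \<^const>\<open>valid_path\<close> admits unbounded
  velocities at the finitely many exceptional parameters, a curve may have infinite length; such
  curves are excluded by stating the length with \<open>has_integral\<close>. The value \<open>0\<close> outside \<open>M\<close> only
  serves to fit the locale \<^locale>\<open>Metric_space\<close>.\<close>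

definition riemannian_dist ::
    "'a::euclidean_space set \<Rightarrow> 'a tensor2 \<Rightarrow> 'a \<Rightarrow> 'a \<Rightarrow> real" where
  "riemannian_dist M g p q =
     (if p \<in> M \<and> q \<in> M then
        Inf {L. \<exists>\<gamma>. valid_path \<gamma> \<and> path_image \<gamma> \<subseteq> M \<and> pathstart \<gamma> = p \<and> pathfinish \<gamma> = q \<and>
                ((\<lambda>t. sqrt (g (\<gamma> t) (vector_derivative \<gamma> (at t)) (vector_derivative \<gamma> (at t))))
                   has_integral L) {0..1}}
      else 0)"

definition riemannian_complete :: "'a::euclidean_space set \<Rightarrow> 'a tensor2 \<Rightarrow> bool" where
  "riemannian_complete M g \<longleftrightarrow> Metric_space.mcomplete M (riemannian_dist M g)"

text \<open>Completeness of a definite metric, which refers to \<open>-g\<close> if \<open>g\<close> is negative definite. On a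
  connected \<open>M\<close> the sign of a definite continuous \<open>g\<close> is constant.\<close>

definition definite_complete :: "'a::euclidean_space set \<Rightarrow> 'a tensor2 \<Rightarrow> bool" where
  "definite_complete M g \<longleftrightarrow>
     (\<forall>p\<in>M. pos_definite_at M g p) \<and> riemannian_complete M g \<or>
     (\<forall>p\<in>M. neg_definite_at M g p) \<and> riemannian_complete M (\<lambda>p u v. - g p u v)"

definition euclidean_complete :: "'a::euclidean_space set \<Rightarrow> bool" where
  "euclidean_complete M \<longleftrightarrow> riemannian_complete M (\<lambda>p u v. u \<bullet> v)"

end

theory Submission
  imports Defs
begin

text \<open>
  Let \<open>L = {x \<in> V. h x = 1}\<close>. A component \<open>H\<^sub>0\<close> of \<open>H = U \<inter> L\<close> is relatively open in \<open>L\<close>, and since the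
  closure of \<open>H\<close> lies in \<open>V\<close>, every limit point of \<open>H\<^sub>0\<close> lies in \<open>L\<close> too. So near a limit point
  \<open>p\<close> outside \<open>H\<^sub>0\<close> the hypersurface continues smoothly, and a metric that extends continuously to
  \<open>L\<close> cannot be complete on \<open>H\<^sub>0\<close>: a short curve in \<open>L\<close> from a point of \<open>H\<^sub>0\<close> to \<open>p\<close> leaves \<open>H\<^sub>0\<close>
  after finite length (\<open>complete_imp_closed\<close>). This applies to the Euclidean metric, and to the
  centroaffine metric up to sign, because the latter is \<open>- (1/k)\<close> times the flat Hessian of \<open>h\<close>
  (\<open>centroaffine_metric_eq_hess\<close>) and the Hessian is continuous on \<open>V\<close>. Conversely, on a closed
  \<open>H\<^sub>0\<close> a Cauchy sequence for the induced Euclidean metric converges in the ambient space, hence in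
  \<open>H\<^sub>0\<close> (\<open>closed_imp_complete\<close>).

  Homogeneity makes the local geometry explicit, without the implicit function theorem. Integrating
  Euler's equation along rays shows that \<open>x \<mapsto> h(x)\<^bsup>-1/k\<^esup> x\<close> maps a neighbourhood of a point of \<open>L\<close>
  to \<open>L\<close> and fixes \<open>L\<close> (\<open>radial_chart\<close>). The images of straight segments serve as the curves
  whose existence is needed: they show that \<open>L\<close> is locally connected, that its tangent spaces
  are the kernels of \<open>dh\<close>, and that nearby points of \<open>L\<close> are joined by curves whose length is at most
  a constant times their distance (\<open>short_chart_curves\<close>). In the other direction, positivity of the metric
  and compactness bound the Riemannian distance from below by the Euclidean one locally
  (\<open>d_locally_ge\<close>), so that the limits in the two senses agree.
\<close>

section \<open>Closure properties of \<open>C\<^sup>k\<close> functions\<close>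

lemma has_derivative_frechet:
  "f differentiable (at x) \<Longrightarrow> (f has_derivative frechet_derivative f (at x)) (at x)"
  by (simp add: frechet_derivative_works)

lemma frechet_derivative_cong_open:
  assumes "open S" "x \<in> S" "\<And>y. y \<in> S \<Longrightarrow> f y = g y"
  shows "frechet_derivative f (at x) = frechet_derivative g (at x)"
proof -
  have "(f has_derivative D) (at x) \<longleftrightarrow> (g has_derivative D) (at x)" for D
    using has_derivative_transform_within_open[OF _ assms(1,2), of f D UNIV g]
          has_derivative_transform_within_open[OF _ assms(1,2), of g D UNIV f] assms(3) by auto
  then show ?thesis by (simp add: frechet_derivative_def)
qed

lemma Ck_on_cong:
  assumes "open S" "\<And>x. x \<in> S \<Longrightarrow> f x = g x" "Ck_on k f S"
  shows "Ck_on k g S"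
  using assms(2,3)
proof (induction k arbitrary: f g)
  case 0
  then show ?case by (simp cong: continuous_on_cong)
next
  case (Suc k)
  have "g differentiable (at x)" if "x \<in> S" for x
    using Suc.prems that has_derivative_transform_within_open[OF _ assms(1) that, of f _ UNIV g]
    by (metis Ck_on.simps(2) differentiable_def)
  moreover have "Ck_on k (\<lambda>x. frechet_derivative g (at x) v) S" for v
  proof (rule Suc.IH)
    show "frechet_derivative f (at x) v = frechet_derivative g (at x) v" if "x \<in> S" for x
      using frechet_derivative_cong_open[OF assms(1) that Suc.prems(1)] by simp
  qed (use Suc.prems in auto)
  ultimately show ?case by simp
qed

lemma Ck_on_continuous_on: "Ck_on k f S \<Longrightarrow> continuous_on S f"
  by (cases k) (simp_all add: continuous_at_imp_continuous_on differentiable_imp_continuous_within)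

lemma Ck_on_Suc_D: "Ck_on (Suc k) f S \<Longrightarrow> Ck_on k f S"
proof (induction k arbitrary: f)
  case 0
  then show ?case using Ck_on_continuous_on[OF 0] by simp
next
  case (Suc k)
  then show ?case by (auto simp del: Ck_on.simps simp: Ck_on.simps(2)[of "Suc k"] Ck_on.simps(2)[of k])
qed

text \<open>Every closure property of the \<open>C\<^sup>k\<close> classes below is proved by induction on \<open>k\<close>: a rule of
  differentiation gives the derivative as an expression of the same kind, and this lemma turns the
  rule into the inductive step.\<close>

lemma Ck_on_SucI:
  assumes "open S" "\<And>x. x \<in> S \<Longrightarrow> (f has_derivative D x) (at x)" "\<And>v. Ck_on k (\<lambda>x. D x v) S"
  shows "Ck_on (Suc k) f S"
proof -
  have "frechet_derivative f (at x) = D x" if "x \<in> S" for x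
    using frechet_derivative_at[OF assms(2)[OF that]] by simp
  then have "Ck_on k (\<lambda>x. frechet_derivative f (at x) v) S" for v
    using Ck_on_cong[OF assms(1) _ assms(3)[of v]] by simp
  then show ?thesis using assms(2) by (auto simp: differentiable_def)
qed

lemma Ck_on_const: "open S \<Longrightarrow> Ck_on k (\<lambda>x. c) S"
proof (induction k arbitrary: c)
  case (Suc k)
  show ?case by (rule Ck_on_SucI[where D = "\<lambda>x v. 0"]) (use Suc in auto)
qed simp

lemma Ck_on_bounded_linear:
  assumes "open S" "bounded_linear f"
  shows "Ck_on k f S"
proof (cases k)
  case 0
  then show ?thesis using assms by (simp add: linear_continuous_on)
next
  case (Suc j)
  show ?thesis unfolding Suc
    by (rule Ck_on_SucI[OF assms(1) bounded_linear_imp_has_derivative[OF assms(2)]])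
       (rule Ck_on_const[OF assms(1)])
qed

lemma Ck_on_add:
  assumes "open S" "Ck_on k f S" "Ck_on k g S"
  shows "Ck_on k (\<lambda>x. f x + g x) S"
  using assms(2,3)
proof (induction k arbitrary: f g)
  case 0
  then show ?case by (simp add: continuous_on_add)
next
  case (Suc k)
  show ?case
  proof (rule Ck_on_SucI[OF assms(1)])
    fix x assume "x \<in> S"
    then show "((\<lambda>x. f x + g x) has_derivative
        (\<lambda>v. frechet_derivative f (at x) v + frechet_derivative g (at x) v)) (at x)"
      using Suc.prems by (intro has_derivative_add has_derivative_frechet) auto
  qed (use Suc in auto)
qed

lemma Ck_on_scaleR:
  fixes f :: "'a::euclidean_space \<Rightarrow> real"
  assumes "open S" "Ck_on k f S" "Ck_on k g S"
  shows "Ck_on k (\<lambda>x. f x *\<^sub>R g x) S"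
  using assms(2,3)
proof (induction k arbitrary: f g)
  case 0
  then show ?case by (simp add: continuous_on_scaleR)
next
  case (Suc k)
  show ?case
  proof (rule Ck_on_SucI[OF assms(1)])
    fix x assume "x \<in> S"
    then show "((\<lambda>x. f x *\<^sub>R g x) has_derivative
        (\<lambda>v. f x *\<^sub>R frechet_derivative g (at x) v + frechet_derivative f (at x) v *\<^sub>R g x)) (at x)"
      using Suc.prems by (intro has_derivative_scaleR has_derivative_frechet) auto
  next
    fix v
    show "Ck_on k (\<lambda>x. f x *\<^sub>R frechet_derivative g (at x) v
                     + frechet_derivative f (at x) v *\<^sub>R g x) S"
      using Suc.prems Suc.prems[THEN Ck_on_Suc_D]
      by (intro Ck_on_add[OF assms(1)] Suc.IH) auto
  qed
qed

text \<open>The exponent varies in the induction because differentiation lowers it by one.\<close>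

lemma Ck_on_powr:
  fixes f :: "'a::euclidean_space \<Rightarrow> real"
  assumes "open S" "Ck_on k f S" "\<And>x. x \<in> S \<Longrightarrow> f x > 0"
  shows "Ck_on k (\<lambda>x. f x powr a) S"
  using assms(2)
proof (induction k arbitrary: a)
  case 0
  then show ?case using assms(3) by (auto intro!: continuous_intros simp: less_imp_neq[symmetric])
next
  case (Suc k)
  show ?case
  proof (rule Ck_on_SucI[OF assms(1)])
    fix x assume x: "x \<in> S"
    have "(f has_derivative frechet_derivative f (at x)) (at x)"
      using Suc.prems x by (intro has_derivative_frechet) auto
    from has_derivative_powr[OF this has_derivative_const[of a "at x"]] assms(3)[OF x]
    show "((\<lambda>x. f x powr a) has_derivative
        (\<lambda>v. (a * f x powr (a - 1)) *\<^sub>R frechet_derivative f (at x) v)) (at x)"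
      by (simp add: powr_diff field_simps)
  next
    fix v
    have "Ck_on k (\<lambda>x. a *\<^sub>R f x powr (a - 1)) S"
      by (intro Ck_on_scaleR[OF assms(1)] Ck_on_const[OF assms(1)] Suc.IH Ck_on_Suc_D[OF Suc.prems])
    then show "Ck_on k (\<lambda>x. (a * f x powr (a - 1)) *\<^sub>R frechet_derivative f (at x) v) S"
      using Suc.prems by (intro Ck_on_scaleR[OF assms(1)]) auto
  qed
qed

lemma Ck_on_along_line:
  fixes p v :: "'a::euclidean_space"
  assumes "Ck_on k f S" "open T" "\<And>t. t \<in> T \<Longrightarrow> p + t *\<^sub>R v \<in> S"
  shows "Ck_on k (\<lambda>t::real. f (p + t *\<^sub>R v)) T"
  using assms(1)
proof (induction k arbitrary: f)
  case 0
  then show ?case using assms(3)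
    by (auto intro!: continuous_on_compose2[of S f] continuous_intros)
next
  case (Suc k)
  show ?case
  proof (rule Ck_on_SucI[OF assms(2)])
    fix t assume t: "t \<in> T"
    have D: "(f has_derivative frechet_derivative f (at (p + t *\<^sub>R v))) (at (p + t *\<^sub>R v))"
      using Suc.prems assms(3)[OF t] by (intro has_derivative_frechet) auto
    have "((\<lambda>t. p + t *\<^sub>R v) has_derivative (\<lambda>s. s *\<^sub>R v)) (at t)"
      by (auto intro!: derivative_eq_intros)
    from has_derivative_compose[OF this D]
    show "((\<lambda>t. f (p + t *\<^sub>R v)) has_derivative
        (\<lambda>s. s *\<^sub>R frechet_derivative f (at (p + t *\<^sub>R v)) v)) (at t)"
      by (simp add: linear_cmul[OF has_derivative_linear[OF D]])
  next
    fix s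
    show "Ck_on k (\<lambda>t. s *\<^sub>R frechet_derivative f (at (p + t *\<^sub>R v)) v) T"
      using Suc by (intro Ck_on_scaleR[OF assms(2)] Ck_on_const[OF assms(2)]) auto
  qed
qed

section \<open>Lengths of curves\<close>

text \<open>The set whose infimum is the Riemannian distance. Working with the set keeps the two questions
  apart on which properties of the infimum depend: whether it is bounded below by zero, and whether
  it is nonempty.\<close>

definition curve_lengths :: "'a::euclidean_space set \<Rightarrow> 'a tensor2 \<Rightarrow> 'a \<Rightarrow> 'a \<Rightarrow> real set" where
  "curve_lengths M g p q =
     {L. \<exists>\<gamma>. valid_path \<gamma> \<and> path_image \<gamma> \<subseteq> M \<and> pathstart \<gamma> = p \<and> pathfinish \<gamma> = q \<and>
        ((\<lambda>t. sqrt (g (\<gamma> t) (vector_derivative \<gamma> (at t)) (vector_derivative \<gamma> (at t))))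
           has_integral L) {0..1}}"

lemma riemannian_dist_curve_lengths:
  "p \<in> M \<Longrightarrow> q \<in> M \<Longrightarrow> riemannian_dist M g p q = Inf (curve_lengths M g p q)"
  by (simp add: riemannian_dist_def curve_lengths_def)

lemma valid_path_derivative:
  assumes "valid_path \<gamma>"
  obtains S where "finite S"
    "\<And>t. t \<in> {0..1} - S \<Longrightarrow> (\<gamma> has_vector_derivative vector_derivative \<gamma> (at t)) (at t)"
proof -
  from assms obtain S where "finite S" "\<forall>t\<in>{0..1} - S. \<gamma> differentiable at t"
    by (auto simp: valid_path_def piecewise_C1_differentiable_on_def C1_differentiable_on_eq)
  then show ?thesis by (intro that) (auto simp: vector_derivative_works)
qed

text \<open>Concatenation doubles the velocity of both halves, which is why the metric must scale by 4
  under doubling. The integral ignores the finitely many parameters at which a velocity is missing.\<close>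

lemma curve_lengths_join:
  assumes hom: "\<And>x u. x \<in> M \<Longrightarrow> g x (2 *\<^sub>R u) (2 *\<^sub>R u) = 4 * g x u u"
    and "L1 \<in> curve_lengths M g p q" "L2 \<in> curve_lengths M g q r"
  shows "L1 + L2 \<in> curve_lengths M g p r"
proof -
  let ?f = "\<lambda>\<gamma> t. sqrt (g (\<gamma> t) (vector_derivative \<gamma> (at t)) (vector_derivative \<gamma> (at t)))"
  obtain g1 where g1: "valid_path g1" "path_image g1 \<subseteq> M" "pathstart g1 = p" "pathfinish g1 = q"
    "(?f g1 has_integral L1) {0..1}" using assms(2) unfolding curve_lengths_def by blast
  obtain g2 where g2: "valid_path g2" "path_image g2 \<subseteq> M" "pathstart g2 = q" "pathfinish g2 = r"
    "(?f g2 has_integral L2) {0..1}" using assms(3) unfolding curve_lengths_def by blast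
  obtain S1 where S1: "finite S1"
    "\<And>t. t \<in> {0..1} - S1 \<Longrightarrow> (g1 has_vector_derivative vector_derivative g1 (at t)) (at t)"
    using valid_path_derivative[OF g1(1)] by blast
  obtain S2 where S2: "finite S2"
    "\<And>t. t \<in> {0..1} - S2 \<Longrightarrow> (g2 has_vector_derivative vector_derivative g2 (at t)) (at t)"
    using valid_path_derivative[OF g2(1)] by blast
  have sq: "sqrt (g x (2 *\<^sub>R u) (2 *\<^sub>R u)) = 2 * sqrt (g x u u)" if "x \<in> M" for x u
    using hom[OF that] by (simp add: real_sqrt_mult)
  have in1: "g1 t \<in> M" if "t \<in> {0..1}" for t using g1(2) that by (auto simp: path_image_def)
  have in2: "g2 t \<in> M" if "t \<in> {0..1}" for t using g2(2) that by (auto simp: path_image_def)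
  have i1: "((\<lambda>t. 2 * ?f g1 (2 * t)) has_integral L1) {0..1/2}"
    and i2: "((\<lambda>t. 2 * ?f g2 (2 * t - 1)) has_integral L2) {1/2..1}"
    using has_integral_affinity01 [OF g1(5), where m= 2 and c=0, THEN has_integral_cmul [where c=2]]
          has_integral_affinity01 [OF g2(5), where m= 2 and c="-1", THEN has_integral_cmul [where c=2]]
    by (simp_all only: image_affinity_atLeastAtMost_div_diff, simp_all add: scaleR_conv_of_real mult_ac)
  have d1: "vector_derivative (g1 +++ g2) (at z) = 2 *\<^sub>R vector_derivative g1 (at (2*z))"
    if "0 \<le> z" "z*2 < 1" "2*z \<notin> S1" for z
  proof (rule vector_derivative_at [OF has_vector_derivative_transform_within])
    show "0 < \<bar>z - 1/2\<bar>" using that by auto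
    have "((*) 2 has_vector_derivative 2) (at z)"
      by (simp add: has_vector_derivative_def has_derivative_def bounded_linear_mult_left)
    then show "((\<lambda>x. g1 (2 * x)) has_vector_derivative 2 *\<^sub>R vector_derivative g1 (at (2*z))) (at z)"
      using S1(2)[of "2*z"] that by (intro vector_diff_chain_at [simplified o_def]) auto
  qed (use that in \<open>simp_all add: joinpaths_def dist_real_def abs_if split: if_split_asm\<close>)
  have d2: "vector_derivative (g1 +++ g2) (at z) = 2 *\<^sub>R vector_derivative g2 (at (2*z - 1))"
    if "1 < z*2" "z \<le> 1" "2*z - 1 \<notin> S2" for z
  proof (rule vector_derivative_at [OF has_vector_derivative_transform_within])
    show "0 < \<bar>z - 1/2\<bar>" using that by auto
    have "((\<lambda>x. 2 * x - 1) has_vector_derivative 2) (at z)"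
      by (simp add: has_vector_derivative_def has_derivative_def bounded_linear_mult_left)
    then show "((\<lambda>x. g2 (2 * x - 1)) has_vector_derivative 2 *\<^sub>R vector_derivative g2 (at (2*z - 1))) (at z)"
      using S2(2)[of "2*z - 1"] that by (intro vector_diff_chain_at [simplified o_def]) auto
  qed (use that in \<open>simp_all add: joinpaths_def dist_real_def abs_if split: if_split_asm\<close>)
  have "(?f (g1 +++ g2) has_integral L1) {0..1/2}"
  proof (rule has_integral_spike_finite [OF _ _ i1])
    show "finite (insert (1/2) ((*) 2 -` S1))"
      using S1 by (force intro: finite_vimageI [where h = "(*)2"] inj_onI)
    fix t assume "t \<in> {0..1/2} - insert (1/2) ((*) 2 -` S1)"
    then have t: "0 \<le> t" "t*2 < 1" "2*t \<notin> S1" by auto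
    show "?f (g1 +++ g2) t = 2 * ?f g1 (2 * t)"
      unfolding d1[OF t] using t sq[OF in1[of "2*t"]] by (simp add: joinpaths_def)
  qed
  moreover have "(?f (g1 +++ g2) has_integral L2) {1/2..1}"
  proof (rule has_integral_spike_finite [OF _ _ i2])
    show "finite (insert (1/2) ((\<lambda>x. 2 * x - 1) -` S2))"
      using S2 by (force intro: finite_vimageI [where h = "\<lambda>x. 2*x-1"] inj_onI)
    fix t assume "t \<in> {1/2..1} - insert (1/2) ((\<lambda>x. 2 * x - 1) -` S2)"
    then have t: "1 < t*2" "t \<le> 1" "2*t - 1 \<notin> S2" by auto
    show "?f (g1 +++ g2) t = 2 * ?f g2 (2 * t - 1)"
      unfolding d2[OF t] using t sq[OF in2[of "2*t - 1"]] by (simp add: joinpaths_def)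
  qed
  ultimately have "(?f (g1 +++ g2) has_integral L1 + L2) {0..1}"
    by (simp add: has_integral_combine [where c = "1/2"])
  moreover have "valid_path (g1 +++ g2)" "path_image (g1 +++ g2) \<subseteq> M"
    using g1 g2 by (auto intro: valid_path_join simp: path_image_join)
  ultimately show ?thesis unfolding curve_lengths_def using g1 g2
    by (intro CollectI exI[of _ "g1 +++ g2"]) simp
qed

lemma curve_lengths_reverse:
  assumes hom: "\<And>x u. x \<in> M \<Longrightarrow> g x (- u) (- u) = g x u u"
    and "L \<in> curve_lengths M g p q"
  shows "L \<in> curve_lengths M g q p"
proof -
  let ?f = "\<lambda>\<gamma> t. sqrt (g (\<gamma> t) (vector_derivative \<gamma> (at t)) (vector_derivative \<gamma> (at t)))"
  obtain \<gamma> where \<gamma>: "valid_path \<gamma>" "path_image \<gamma> \<subseteq> M" "pathstart \<gamma> = p" "pathfinish \<gamma> = q"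
    "(?f \<gamma> has_integral L) {0..1}" using assms(2) unfolding curve_lengths_def by blast
  obtain S where S: "finite S"
    "\<And>t. t \<in> {0..1} - S \<Longrightarrow> (\<gamma> has_vector_derivative vector_derivative \<gamma> (at t)) (at t)"
    using valid_path_derivative[OF \<gamma>(1)] by blast
  have i: "((\<lambda>t. ?f \<gamma> (1 - t)) has_integral L) {0..1}"
    using has_integral_affinity01 [OF \<gamma>(5), where m= "-1" and c=1] by simp
  have "(?f (reversepath \<gamma>) has_integral L) {0..1}"
  proof (rule has_integral_spike_finite[OF _ _ i])
    show "finite ((\<lambda>t. 1 - t) ` S)" using S by simp
    fix t assume "t \<in> {0..1} - (\<lambda>t. 1 - t) ` S"
    then have t: "t \<in> {0..1}" "1 - t \<in> {0..1} - S" by (auto simp: image_iff)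
    have "((\<lambda>t. 1 - t) has_vector_derivative -1) (at t)"
      by (auto intro!: derivative_eq_intros)
    from vector_diff_chain_at[OF this S(2)[OF t(2)]]
    have "vector_derivative (reversepath \<gamma>) (at t) = - vector_derivative \<gamma> (at (1 - t))"
      by (intro vector_derivative_at) (simp add: reversepath_def o_def)
    moreover have "\<gamma> (1 - t) \<in> M" using t \<gamma>(2) by (auto simp: path_image_def)
    ultimately show "?f (reversepath \<gamma>) t = ?f \<gamma> (1 - t)"
      using hom by (simp add: reversepath_def)
  qed
  then show ?thesis unfolding curve_lengths_def using \<gamma>
    by (intro CollectI exI[of _ "reversepath \<gamma>"]) simp
qed

lemma curve_lengths_refl:
  assumes "p \<in> M" "g p 0 0 = 0"
  shows "0 \<in> curve_lengths M g p p"
  unfolding curve_lengths_def using assms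
  by (intro CollectI exI[of _ "linepath p p"]) auto

section \<open>Level sets of homogeneous functions\<close>

text \<open>A derivative is given as a family of directional derivatives, each continuous in the base point.
  Expanding the direction in an orthonormal basis makes it jointly continuous in point and direction,
  which the compactness arguments for the metric require.\<close>

lemma continuous_on_linear_family:
  fixes D :: "'a::topological_space \<Rightarrow> 'b::euclidean_space \<Rightarrow> 'c::real_normed_vector"
  assumes "\<And>x. x \<in> S \<Longrightarrow> linear (D x)" "\<And>u. continuous_on S (\<lambda>x. D x u)"
  shows "continuous_on (S \<times> UNIV) (\<lambda>(x, u). D x u)"
proof -
  have "D x u = (\<Sum>b\<in>Basis. (u \<bullet> b) *\<^sub>R D x b)" if "x \<in> S" for x u
    using linear_sum[OF assms(1)[OF that], of "\<lambda>b. (u \<bullet> b) *\<^sub>R b" Basis]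
    by (simp add: linear_cmul[OF assms(1)[OF that]] euclidean_representation)
  moreover have "continuous_on (S \<times> UNIV) (\<lambda>(x, u). \<Sum>b\<in>Basis. (u \<bullet> b) *\<^sub>R D x b)"
    unfolding case_prod_unfold
    by (intro continuous_intros continuous_on_compose2[OF assms(2)]) auto
  ultimately show ?thesis by (force elim: continuous_on_eq)
qed

locale homogeneous_function =
  fixes h :: "real ^ 'm \<Rightarrow> real" and k :: real and V :: "(real ^ 'm) set"
  assumes open_V: "open V" and smooth_h: "smooth_on h V"
    and k_nonzero: "k \<noteq> 0" and homogeneous: "homogeneous_on h k V"
begin

abbreviation dh :: "real ^ 'm \<Rightarrow> real ^ 'm \<Rightarrow> real" where
  "dh x \<equiv> frechet_derivative h (at x)"

abbreviation level :: "(real ^ 'm) set" where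
  "level \<equiv> {x \<in> V. h x = 1}"

lemma has_derivative_h: "x \<in> V \<Longrightarrow> (h has_derivative dh x) (at x)"
  using smooth_h unfolding smooth_on_def
  by (intro has_derivative_frechet) (metis Ck_on.simps(2))

lemma linear_dh: "x \<in> V \<Longrightarrow> linear (dh x)"
  using has_derivative_h has_derivative_linear by blast

lemma continuous_h: "continuous_on V h"
  using smooth_h Ck_on.simps(1) unfolding smooth_on_def by blast

lemma smooth_dh: "smooth_on (\<lambda>x. dh x v) V"
  using smooth_h unfolding smooth_on_def by (metis Ck_on.simps(2))

lemma continuous_dh: "continuous_on (V \<times> UNIV) (\<lambda>(x, u). dh x u)"
  using smooth_dh linear_dh unfolding smooth_on_def
  by (intro continuous_on_linear_family) (metis Ck_on.simps(1))+

lemma euler: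
  assumes "x \<in> V"
  shows "dh x x = k * h x"
proof -
  have "dh x (\<Sum>i\<in>UNIV. (x $ i) *\<^sub>R axis i 1) = (\<Sum>i\<in>UNIV. x $ i * dh x (axis i 1))"
    using linear_dh[OF assms] by (simp add: linear_sum linear_cmul)
  then show ?thesis
    using homogeneous assms basis_expansion[of x]
    by (simp add: homogeneous_on_def scalar_mult_eq_scaleR)
qed

text \<open>The flat Hessian of \<open>h\<close>. The slot that is differentiated first is expanded in a basis, which
  makes linearity in it immediate and gives directly the derivative of \<open>dh q (Y q)\<close> for a vector
  field \<open>Y\<close>.\<close>

definition hess :: "real ^ 'm \<Rightarrow> real ^ 'm \<Rightarrow> real ^ 'm \<Rightarrow> real" where
  "hess p u v = (\<Sum>b\<in>Basis. (v \<bullet> b) * frechet_derivative (\<lambda>x. dh x b) (at p) u)"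

lemma has_derivative_dh:
  assumes "p \<in> V"
  shows "((\<lambda>x. dh x v) has_derivative frechet_derivative (\<lambda>x. dh x v) (at p)) (at p)"
  using smooth_dh[of v] assms unfolding smooth_on_def
  by (intro has_derivative_frechet) (metis Ck_on.simps(2))

lemma continuous_hess: "continuous_on (V \<times> UNIV) (\<lambda>(p, u). hess p u u)"
proof -
  have "continuous_on (V \<times> UNIV) (\<lambda>(p, u). frechet_derivative (\<lambda>x. dh x b) (at p) u)" for b
  proof (rule continuous_on_linear_family)
    show "linear (frechet_derivative (\<lambda>x. dh x b) (at p))" if "p \<in> V" for p
      using has_derivative_dh[OF that] has_derivative_linear by blast
    show "continuous_on V (\<lambda>x. frechet_derivative (\<lambda>x. dh x b) (at x) u)" for u
      using smooth_dh[of b] unfolding smooth_on_def by (metis Ck_on.simps)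
  qed
  then show ?thesis
    unfolding hess_def case_prod_unfold by (intro continuous_intros) auto
qed

lemma hess_scaleR:
  assumes "p \<in> V"
  shows "hess p (c *\<^sub>R u) (c *\<^sub>R u) = c\<^sup>2 * hess p u u"
  unfolding hess_def
  by (simp add: linear_cmul[OF has_derivative_linear[OF has_derivative_dh[OF assms]]]
      sum_distrib_left power2_eq_square mult_ac)

text \<open>Euler's equation says that \<open>s\<^sup>-\<^sup>k h(s x)\<close> has derivative zero in \<open>s\<close>. The segment must lie in \<open>V\<close>
  because Euler's equation does not relate the values of \<open>h\<close> on different components of a ray
  in \<open>V\<close>.\<close>

lemma homogeneous_along_ray:
  assumes "t > 0" "closed_segment x (t *\<^sub>R x) \<subseteq> V"
  shows "h (t *\<^sub>R x) = t powr k * h x"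
proof -
  let ?I = "closed_segment 1 t"
  have "\<exists>c. \<forall>s\<in>?I. s powr (-k) * h (s *\<^sub>R x) = c"
  proof (rule has_field_derivative_zero_constant)
    fix s assume s: "s \<in> ?I"
    then have pos: "s > 0" using assms(1) by (auto simp: closed_segment_eq_real_ivl split: if_splits)
    obtain a where "0 \<le> a" "a \<le> 1" "s = (1 - a) + a * t"
      using s by (auto simp: in_segment)
    then have "s *\<^sub>R x \<in> closed_segment x (t *\<^sub>R x)"
      by (auto simp: in_segment scaleR_add_left intro!: exI[of _ a])
    then have V: "s *\<^sub>R x \<in> V" using assms(2) by blast
    have "((\<lambda>s. s *\<^sub>R x) has_derivative (\<lambda>r. r *\<^sub>R x)) (at s)"
      by (auto intro!: derivative_eq_intros)
    from has_derivative_compose[OF this has_derivative_h[OF V]]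
    have "((\<lambda>s. h (s *\<^sub>R x)) has_real_derivative dh (s *\<^sub>R x) x) (at s)"
      by (simp add: has_field_derivative_def linear_cmul[OF linear_dh[OF V]] mult.commute[of _ "dh _ _"])
    moreover have "dh (s *\<^sub>R x) x = k * h (s *\<^sub>R x) / s"
      using euler[OF V] linear_cmul[OF linear_dh[OF V]] pos by (simp add: field_simps)
    ultimately have "((\<lambda>s. h (s *\<^sub>R x)) has_real_derivative k * h (s *\<^sub>R x) / s) (at s)"
      by simp
    from DERIV_mult[OF has_real_derivative_powr[OF pos, of "-k"] this]
    have "((\<lambda>s. s powr (-k) * h (s *\<^sub>R x)) has_real_derivative 0) (at s)"
      using pos by (simp add: powr_diff)
    then show "((\<lambda>s. s powr (-k) * h (s *\<^sub>R x)) has_real_derivative 0) (at s within ?I)"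
      by (rule has_field_derivative_at_within)
  qed simp
  then have "t powr (-k) * h (t *\<^sub>R x) = h x"
    by (metis ends_in_segment mult_1 powr_one_eq_one scaleR_one)
  then show ?thesis using assms(1) by (auto simp: powr_minus field_simps)
qed

text \<open>The projection along rays to the level set, as \<open>homogeneous_along_ray\<close> shows for points
  near it. It fixes the level set pointwise, so it replaces charts of the level set: it maps
  segments in the ambient space to curves in the level set.\<close>

definition radial :: "real ^ 'm \<Rightarrow> real ^ 'm" where
  "radial x = h x powr (- 1 / k) *\<^sub>R x"

lemma radial_level: "x \<in> level \<Longrightarrow> radial x = x"
  by (simp add: radial_def)

definition dradial :: "real ^ 'm \<Rightarrow> real ^ 'm \<Rightarrow> real ^ 'm" where
  "dradial x u = h x powr (- 1 / k) *\<^sub>R u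
     + (- 1 / k * h x powr (- 1 / k - 1) * dh x u) *\<^sub>R x"

lemma dradial_scaleR: "x \<in> V \<Longrightarrow> dradial x (c *\<^sub>R u) = c *\<^sub>R dradial x u"
  by (simp add: dradial_def linear_cmul[OF linear_dh] scaleR_right_diff_distrib mult_ac)

lemma has_derivative_radial:
  assumes "x \<in> V" "h x > 0"
  shows "(radial has_derivative dradial x) (at x)"
proof -
  have "((\<lambda>x. h x powr (- 1 / k)) has_derivative
      (\<lambda>u. - 1 / k * h x powr (- 1 / k - 1) * dh x u)) (at x)"
    using has_derivative_powr[OF has_derivative_h[OF assms(1)]
        has_derivative_const[of "- 1 / k" "at x"]] assms(2)
    by (simp add: powr_diff field_simps)
  from has_derivative_scaleR[OF this has_derivative_ident]
  show ?thesis unfolding radial_def[abs_def] dradial_def[abs_def] by simp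
qed

lemma continuous_radial: "continuous_on {x \<in> V. h x > 0} radial"
  using has_derivative_radial
  by (auto intro!: continuous_at_imp_continuous_on has_derivative_continuous)

lemma continuous_dradial: "continuous_on ({x \<in> V. h x > 0} \<times> UNIV) (\<lambda>(x, u). dradial x u)"
proof -
  have "continuous_on ({x \<in> V. h x > 0} \<times> UNIV) (\<lambda>z. h (fst z))"
    by (rule continuous_on_compose2[OF continuous_h]) (auto intro!: continuous_intros)
  moreover have "continuous_on ({x \<in> V. h x > 0} \<times> UNIV) (\<lambda>z. dh (fst z) (snd z))"
    using continuous_dh by (auto simp: case_prod_unfold intro: continuous_on_subset)
  ultimately show ?thesis
    unfolding dradial_def case_prod_unfold by (intro continuous_intros) auto
qed

text \<open>Near \<open>p\<close>, a point and its projection both lie in one ball inside \<open>V\<close>. By convexity the segment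
  between them does too, so that homogeneity applies along it.\<close>

lemma radial_chart:
  assumes p: "p \<in> level" and N: "open N" "p \<in> N"
  obtains s where "s > 0" "\<And>x. x \<in> cball p s \<Longrightarrow> x \<in> V \<and> h x > 0 \<and> radial x \<in> level \<inter> N"
proof -
  obtain r where r: "r > 0" "ball p r \<subseteq> V \<inter> N"
    using open_contains_ball[of "V \<inter> N"] open_V N p by (metis IntI mem_Collect_eq open_Int)
  have "isCont h p" "isCont radial p"
    using has_derivative_h[of p] has_derivative_radial[of p] p has_derivative_continuous by auto
  then have "\<forall>\<^sub>F x in at p. h x > 0" "\<forall>\<^sub>F x in at p. radial x \<in> ball p r"
    using p r radial_level[OF p] order_tendstoD(1)[of h 1 "at p" 0]
      topological_tendstoD[of radial p "at p" "ball p r"] by (simp_all add: isCont_def)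
  moreover have "\<forall>\<^sub>F x in at p. x \<in> ball p r"
    using r by (intro eventually_at_in_open') auto
  ultimately have "\<forall>\<^sub>F x in at p. h x > 0 \<and> radial x \<in> ball p r \<and> x \<in> ball p r"
    by eventually_elim auto
  then obtain d where d: "d > 0"
    "\<And>x. x \<noteq> p \<Longrightarrow> dist x p < d \<Longrightarrow> h x > 0 \<and> radial x \<in> ball p r \<and> x \<in> ball p r"
    unfolding eventually_at by blast
  show thesis
  proof (rule that[of "d/2"])
    fix x assume "x \<in> cball p (d/2)"
    then have x: "h x > 0" "radial x \<in> ball p r" "x \<in> ball p r"
      using d(2)[of x] d(1) p r radial_level[OF p] by (cases "x = p"; auto simp: dist_commute)+
    have "closed_segment x (radial x) \<subseteq> ball p r"
      using x closed_segment_subset[OF _ _ convex_ball] by blast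
    then have "closed_segment x (h x powr (- 1 / k) *\<^sub>R x) \<subseteq> V"
      using r unfolding radial_def by blast
    from homogeneous_along_ray[OF _ this] have "h (radial x) = (h x powr (- 1 / k)) powr k * h x"
      using x(1) by (simp add: radial_def)
    also have "... = 1"
      unfolding powr_powr using x(1) k_nonzero by (simp add: powr_minus)
    finally have "h (radial x) = 1" .
    then show "x \<in> V \<and> h x > 0 \<and> radial x \<in> level \<inter> N" using x r by auto
  qed (use d in auto)
qed

lemma openin_level_cball:
  assumes "openin (top_of_set level) M" "p \<in> M"
  obtains s where "s > 0" "level \<inter> cball p s \<subseteq> M"
    "\<And>x. x \<in> cball p s \<Longrightarrow> x \<in> V \<and> h x > 0 \<and> radial x \<in> M"
proof -
  obtain e where e: "e > 0" "ball p e \<inter> level \<subseteq> M" and "p \<in> level"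
    using assms unfolding openin_contains_ball by blast
  obtain s where s: "s > 0"
    "\<And>x. x \<in> cball p s \<Longrightarrow> x \<in> V \<and> h x > 0 \<and> radial x \<in> level \<inter> ball p e"
    using radial_chart[OF \<open>p \<in> level\<close>, of "ball p e"] e(1) by auto
  have "radial x \<in> M" if "x \<in> cball p s" for x using s(2)[OF that] e(2) by blast
  moreover from this have "level \<inter> cball p s \<subseteq> M" using radial_level by fastforce
  ultimately show thesis using that s by blast
qed

text \<open>The level set is locally connected: the projection of a ball is a connected neighbourhood of its
  centre in the level set.\<close>

lemma component_openin_level:
  assumes "openin (top_of_set level) H" "C \<in> components H"
  shows "openin (top_of_set level) C"
  unfolding openin_contains_ball
proof (intro conjI ballI)
  show CL: "C \<subseteq> level"
    using assms in_components_subset openin_imp_subset by blast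
  fix p assume p: "p \<in> C"
  then have "p \<in> H" using assms(2) in_components_subset by blast
  then obtain s where s: "s > 0" "level \<inter> cball p s \<subseteq> H"
    "\<And>x. x \<in> cball p s \<Longrightarrow> x \<in> V \<and> h x > 0 \<and> radial x \<in> H"
    by (rule openin_level_cball[OF assms(1)]) blast
  have "radial ` cball p s \<subseteq> C"
  proof (rule components_maximal[OF assms(2)])
    show "connected (radial ` cball p s)"
      by (intro connected_continuous_image continuous_on_subset[OF continuous_radial]) (use s in auto)
    show "C \<inter> radial ` cball p s \<noteq> {}"
      using p s(1) radial_level[of p] CL by (force intro!: image_eqI[of _ _ p])
  qed (use s in auto)
  then have "x \<in> C" if "x \<in> ball p s \<inter> level" for x
    using that radial_level[of x] image_eqI[of x radial x "cball p s"] \<open>radial ` _ \<subseteq> C\<close> by auto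
  then have "ball p s \<inter> level \<subseteq> C" by blast
  then show "\<exists>e>0. ball p e \<inter> level \<subseteq> C" using s by blast
qed

lemma velocity_in_level:
  assumes "open T" "t \<in> T" "c ` T \<subseteq> level" "(c has_vector_derivative v) (at t)"
  shows "dh (c t) v = 0"
proof -
  have "((\<lambda>s. h (c s)) has_derivative (\<lambda>s. dh (c t) (s *\<^sub>R v))) (at t)"
    using assms(2,3) by (intro has_derivative_compose[OF assms(4)[unfolded has_vector_derivative_def]]
      has_derivative_h) auto
  then have "((\<lambda>s. 1::real) has_derivative (\<lambda>s. dh (c t) (s *\<^sub>R v))) (at t)"
    by (rule has_derivative_transform_within_open[OF _ assms(1,2)]) (use assms(3) in auto)
  then have "(\<lambda>s. dh (c t) (s *\<^sub>R v)) = (\<lambda>s. 0)"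
    using has_derivative_unique has_derivative_const by blast
  from fun_cong[OF this, of 1] show ?thesis by simp
qed

text \<open>For the inclusion from right to left, the projection of the straight line through \<open>p\<close> in
  direction \<open>v\<close> is a curve in the level set. Its velocity at \<open>p\<close> is \<open>v\<close>, as \<open>dradial p\<close> is the identity on
  the kernel of \<open>dh p\<close>.\<close>

lemma tangent_space_level:
  assumes M: "openin (top_of_set level) M" and p: "p \<in> M"
  shows "tangent_space M p = {v. dh p v = 0}"
proof (intro equalityI subsetI CollectI)
  fix v assume "v \<in> tangent_space M p"
  then obtain c e where c: "e > 0" "c ` {-e<..<e::real} \<subseteq> M" "c 0 = p"
    "(c has_vector_derivative v) (at 0)" unfolding tangent_space_def by blast
  moreover have "c ` {-e<..<e} \<subseteq> level" using c(2) openin_imp_subset[OF M] by blast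
  ultimately show "dh p v = 0" using velocity_in_level[of "{-e<..<e}" 0 c v] by auto
next
  have pL: "p \<in> level" using assms openin_imp_subset by blast
  fix v assume "v \<in> {v. dh p v = 0}"
  then have v: "dh p v = 0" by simp
  obtain s where s: "s > 0" "level \<inter> cball p s \<subseteq> M"
    "\<And>x. x \<in> cball p s \<Longrightarrow> x \<in> V \<and> h x > 0 \<and> radial x \<in> M"
    by (rule openin_level_cball[OF M p]) blast
  define e where "e = s / (norm v + 1)"
  have e: "e > 0" using s by (simp add: e_def add_nonneg_pos)
  let ?T = "{-e<..<e}"
  have T: "p + t *\<^sub>R v \<in> cball p s" if "t \<in> ?T" for t
  proof -
    have "\<bar>t\<bar> * norm v \<le> e * (norm v + 1)" using that e by (intro mult_mono) auto
    also have "... = s" by (simp add: e_def add_nonneg_pos less_imp_neq[symmetric])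
    finally show ?thesis by (simp add: dist_norm)
  qed
  have "Ck_on j (\<lambda>t. radial (p + t *\<^sub>R v)) ?T" for j
    unfolding radial_def
  proof (intro Ck_on_scaleR Ck_on_powr)
    show "Ck_on j (\<lambda>t. h (p + t *\<^sub>R v)) ?T"
      using smooth_h s(3)[OF T] unfolding smooth_on_def by (intro Ck_on_along_line[of _ _ V]) auto
    show "Ck_on j (\<lambda>t. p + t *\<^sub>R v) ?T"
      by (intro Ck_on_add Ck_on_const Ck_on_bounded_linear bounded_linear_scaleR_left) auto
  qed (use s T in auto)
  moreover have "((\<lambda>t. radial (p + t *\<^sub>R v)) has_vector_derivative v) (at 0)"
  proof -
    have "((\<lambda>t. p + t *\<^sub>R v) has_derivative (\<lambda>t. t *\<^sub>R v)) (at 0)"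
      by (auto intro!: derivative_eq_intros)
    moreover have "(radial has_derivative dradial p) (at (p + 0 *\<^sub>R v))"
      using has_derivative_radial pL by simp
    ultimately have "((\<lambda>t. radial (p + t *\<^sub>R v)) has_derivative (\<lambda>t. dradial p (t *\<^sub>R v))) (at 0)"
      by (rule has_derivative_compose)
    moreover have "dradial p (t *\<^sub>R v) = t *\<^sub>R v" for t
      using pL v by (simp add: dradial_def linear_cmul[OF linear_dh])
    ultimately show ?thesis by (simp add: has_vector_derivative_def)
  qed
  ultimately show "v \<in> tangent_space M p"
    unfolding tangent_space_def smooth_on_def
  proof (intro CollectI exI conjI)
    show "(\<lambda>t. radial (p + t *\<^sub>R v)) ` ?T \<subseteq> M" using T s by blast
  qed (use e radial_level[OF pL] in auto)
qed

text \<open>If \<open>Y\<close> is tangent to the level set then \<open>dh q (Y q) = 0\<close> along it. Differentiating this in the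
  tangent direction \<open>u\<close> gives \<open>hess p u v + dh p (DY u) = 0\<close>. Since \<open>dh p p = k\<close>, subtracting
  \<open>c p\<close> from \<open>DY u\<close> makes it tangent exactly for \<open>c = - hess p u v / k\<close>. The number is well defined
  only because a tangent extension of \<open>v\<close> exists; the field that subtracts from \<open>v\<close> its component
  along the position vector is one.\<close>

lemma centroaffine_metric_eq_hess:
  assumes H: "openin (top_of_set level) H" and p: "p \<in> H"
    and u: "dh p u = 0" and v: "dh p v = 0"
  shows "centroaffine_metric H p u v = - hess p u v / k"
proof -
  have HL: "H \<subseteq> level" using H openin_imp_subset by blast
  then have pV: "p \<in> V" and hp: "h p = 1" using p by auto
  note lin = linear_add[OF linear_dh] linear_diff[OF linear_dh] linear_cmul[OF linear_dh]
  let ?admissible = "\<lambda>Y W. open W \<and> p \<in> W \<and> smooth_on Y W \<and>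
    (\<forall>q\<in>H \<inter> W. Y q \<in> tangent_space H q) \<and> Y p = v"
  have tangential_part: "frechet_derivative Y (at p) u - c *\<^sub>R p \<in> tangent_space H p
      \<longleftrightarrow> c = - hess p u v / k" if adm: "?admissible Y W" for Y W c
  proof -
    define DY where "DY = frechet_derivative Y (at p)"
    have DY: "(Y has_derivative DY) (at p)"
      unfolding DY_def using adm unfolding smooth_on_def
      by (intro has_derivative_frechet) (metis Ck_on.simps(2))
    let ?F = "\<lambda>q. \<Sum>b\<in>Basis. (Y q \<bullet> b) * dh q b"
    have expand: "(\<Sum>b\<in>Basis. (w \<bullet> b) * dh q b) = dh q w" if "q \<in> V" for q w
      using linear_sum[OF linear_dh[OF that], of "\<lambda>b. (w \<bullet> b) *\<^sub>R b" Basis]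
      by (simp add: linear_cmul[OF linear_dh[OF that]] euclidean_representation)
    have "(?F has_derivative (\<lambda>w. \<Sum>b\<in>Basis. (Y p \<bullet> b) * frechet_derivative (\<lambda>x. dh x b) (at p) w
        + (DY w \<bullet> b) * dh p b)) (at p)"
      by (intro has_derivative_sum has_derivative_mult has_derivative_dh[OF pV]
          has_derivative_inner_left[OF DY])
    then have F: "(?F has_derivative (\<lambda>w. hess p w v + dh p (DY w))) (at p)"
      using adm expand[OF pV] by (simp add: sum.distrib hess_def)
    have "u \<in> tangent_space H p" using tangent_space_level[OF H p] u by simp
    then obtain \<gamma> e where \<gamma>: "e > 0" "\<gamma> ` {-e<..<e::real} \<subseteq> H" "\<gamma> 0 = p"
      "(\<gamma> has_vector_derivative u) (at 0)" unfolding tangent_space_def by blast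
    have D1: "((\<lambda>t. ?F (\<gamma> t)) has_derivative (\<lambda>s. hess p (s *\<^sub>R u) v + dh p (DY (s *\<^sub>R u)))) (at 0)"
      using has_derivative_compose[OF \<gamma>(4)[unfolded has_vector_derivative_def], of ?F] F \<gamma>(3) by simp
    have "isCont \<gamma> 0" using \<gamma>(4) has_vector_derivative_continuous by blast
    then have "\<forall>\<^sub>F t in at 0. \<gamma> t \<in> W"
      using adm \<gamma>(3) by (auto simp: isCont_def intro: topological_tendstoD)
    moreover have "\<forall>\<^sub>F t in at 0. t \<in> {-e<..<e}" using \<gamma>(1) by (intro eventually_at_in_open') auto
    ultimately have "\<forall>\<^sub>F t in at 0. ?F (\<gamma> t) = 0"
    proof eventually_elim
      case (elim t)
      then have "\<gamma> t \<in> H \<inter> W" using \<gamma>(2) by auto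
      then have "dh (\<gamma> t) (Y (\<gamma> t)) = 0" using adm tangent_space_level[OF H] by auto
      then show ?case using expand \<open>\<gamma> t \<in> H \<inter> W\<close> HL by auto
    qed
    moreover have "?F (\<gamma> 0) = 0"
      using expand[OF pV] \<gamma>(3) adm v by simp
    ultimately have "((\<lambda>t. 0::real) has_derivative (\<lambda>s. hess p (s *\<^sub>R u) v + dh p (DY (s *\<^sub>R u)))) (at 0)"
      using has_derivative_transform_eventually[OF D1] by simp
    then have "(\<lambda>s. hess p (s *\<^sub>R u) v + dh p (DY (s *\<^sub>R u))) = (\<lambda>s. 0)"
      using has_derivative_unique has_derivative_const by blast
    from fun_cong[OF this, of 1] have "hess p u v + dh p (DY u) = 0" by simp
    then have "dh p (DY u - c *\<^sub>R p) = - hess p u v - c * k"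
      using lin[OF pV] euler[OF pV] hp by simp
    moreover have "- hess p u v - c * k = 0 \<longleftrightarrow> c = - hess p u v / k"
      using k_nonzero by (auto simp: field_simps)
    ultimately show ?thesis
      using tangent_space_level[OF H p] by (simp add: DY_def[symmetric])
  qed
  (* As dh q q = k on the level set, dh q (?Y q) = 0 there; and ?Y p = v as v is tangent at p. *)
  let ?Y = "\<lambda>q. v + (- 1 / k * dh q v) *\<^sub>R q"
  have "Ck_on j ?Y V" for j
  proof (rule Ck_on_add[OF open_V Ck_on_const[OF open_V]
        Ck_on_scaleR[OF open_V _ Ck_on_bounded_linear[OF open_V bounded_linear_ident]]])
    show "Ck_on j (\<lambda>q. - 1 / k * dh q v) V"
      using Ck_on_scaleR[OF open_V Ck_on_const[OF open_V, of j "- 1 / k"], of "\<lambda>q. dh q v"]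
        smooth_dh[of v] unfolding smooth_on_def by simp
  qed
  moreover have "?Y q \<in> tangent_space H q" if "q \<in> H" for q
  proof -
    have "q \<in> V" "h q = 1" using that HL by auto
    then show ?thesis using tangent_space_level[OF H that] lin euler k_nonzero by simp
  qed
  ultimately have Y: "?admissible ?Y V"
    using pV v open_V by (auto simp: smooth_on_def)
  have "c = - hess p u v / k"
    if "\<forall>Y W. ?admissible Y W \<longrightarrow> frechet_derivative Y (at p) u - c *\<^sub>R p \<in> tangent_space H p" for c
  proof -
    have "frechet_derivative ?Y (at p) u - c *\<^sub>R p \<in> tangent_space H p"
      by (rule mp[OF spec[OF spec[OF that, of ?Y], of V] Y])
    then show ?thesis using tangential_part[OF Y] by simp
  qed
  moreover have "\<forall>Y W. ?admissible Y W \<longrightarrow>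
      frechet_derivative Y (at p) u - (- hess p u v / k) *\<^sub>R p \<in> tangent_space H p"
    using tangential_part by blast
  ultimately show ?thesis
    unfolding centroaffine_metric_def by (intro the_equality) blast+
qed

lemma velocity_tangent:
  assumes "M \<subseteq> level" "path_image \<gamma> \<subseteq> M" "t \<in> {0<..<1}" "(\<gamma> has_vector_derivative v) (at t)"
  shows "dh (\<gamma> t) v = 0"
proof (rule velocity_in_level[OF open_greaterThanLessThan assms(3) _ assms(4)])
  have "\<gamma> ` {0<..<1} \<subseteq> path_image \<gamma>"
    unfolding path_image_def by (intro image_mono) auto
  then show "\<gamma> ` {0<..<1} \<subseteq> level"
    using assms(1,2) by (meson subset_trans)
qed

text \<open>This allows the centroaffine metric, of which only the values on tangent vectors are known, to be
  replaced by the Hessian, which is a bilinear form on the whole ambient space.\<close>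

lemma riemannian_dist_cong_tangent:
  assumes "M \<subseteq> level" and eq: "\<And>p u. p \<in> M \<Longrightarrow> dh p u = 0 \<Longrightarrow> g p u u = g' p u u"
  shows "riemannian_dist M g = riemannian_dist M g'"
proof -
  let ?f = "\<lambda>g \<gamma> t. sqrt (g (\<gamma> t) (vector_derivative \<gamma> (at t)) (vector_derivative \<gamma> (at t)))"
  have "(?f g \<gamma> has_integral L) {0..1} \<longleftrightarrow> (?f g' \<gamma> has_integral L) {0..1}"
    if \<gamma>: "valid_path \<gamma>" "path_image \<gamma> \<subseteq> M" for \<gamma> L
  proof -
    obtain S where S: "finite S"
      "\<And>t. t \<in> {0..1} - S \<Longrightarrow> (\<gamma> has_vector_derivative vector_derivative \<gamma> (at t)) (at t)"
      using valid_path_derivative[OF \<gamma>(1)] by blast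
    have "?f g' \<gamma> t = ?f g \<gamma> t" if "t \<in> {0..1} - (S \<union> {0, 1})" for t
    proof -
      have "dh (\<gamma> t) (vector_derivative \<gamma> (at t)) = 0"
        using that S by (intro velocity_tangent[OF assms(1) \<gamma>(2)]) auto
      moreover have "\<gamma> t \<in> M" using \<gamma>(2) that by (auto simp: path_image_def)
      ultimately show ?thesis using eq by simp
    qed
    then show ?thesis
      using S(1) by (intro has_integral_spike_finite_eq[of "S \<union> {0, 1}"]) auto
  qed
  then have "curve_lengths M g p q = curve_lengths M g' p q" for p q
    unfolding curve_lengths_def by blast
  then show ?thesis
    by (intro ext) (simp add: riemannian_dist_def curve_lengths_def)
qed

end

section \<open>Riemannian metrics on a level set\<close>

text \<open>A Riemannian metric on a connected, relatively open part \<open>M\<close> of the level set. It is required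
  to be positive on \<open>M\<close> only, but to be continuous on all of \<open>V\<close>: at a boundary point of \<open>M\<close>
  inside \<open>V\<close> it may degenerate, yet curves that approach such a point have finite length. The quadratic
  form is all that enters into lengths.\<close>

locale level_metric = homogeneous_function h k V
  for h :: "real ^ 'm \<Rightarrow> real" and k V +
  fixes M :: "(real ^ 'm) set" and g :: "(real ^ 'm) tensor2"
  assumes openin_M: "openin (top_of_set level) M" and connected_M: "connected M"
    and g_scale: "\<And>x c u. x \<in> V \<Longrightarrow> g x (c *\<^sub>R u) (c *\<^sub>R u) = c\<^sup>2 * g x u u"
    and continuous_g: "continuous_on (V \<times> UNIV) (\<lambda>(x, u). g x u u)"
    and g_pos: "\<And>x u. x \<in> M \<Longrightarrow> dh x u = 0 \<Longrightarrow> u \<noteq> 0 \<Longrightarrow> g x u u > 0"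
begin

abbreviation speed :: "real ^ 'm \<Rightarrow> real ^ 'm \<Rightarrow> real" where
  "speed x u \<equiv> sqrt (g x u u)"

abbreviation lengths where "lengths \<equiv> curve_lengths M g"

abbreviation d where "d \<equiv> riemannian_dist M g"

lemma M_level: "M \<subseteq> level" using openin_M openin_imp_subset by blast

lemma M_V: "M \<subseteq> V" using M_level by blast

lemma speed_scale: "x \<in> V \<Longrightarrow> speed x (c *\<^sub>R u) = \<bar>c\<bar> * speed x u"
  by (simp add: g_scale real_sqrt_mult)

lemma speed_nonneg: "x \<in> M \<Longrightarrow> dh x u = 0 \<Longrightarrow> 0 \<le> speed x u"
  using g_pos[of x u] speed_scale[of x 0 u] M_V by (cases "u = 0") auto

lemma speed_bound_from_unit:
  assumes "x \<in> V" "\<And>u. norm u = 1 \<Longrightarrow> dh x u = 0 \<Longrightarrow> c \<le> speed x u" "dh x u = 0"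
  shows "c * norm u \<le> speed x u"
proof (cases "u = 0")
  case True
  then show ?thesis using speed_scale[OF assms(1), of 0 u] by simp
next
  case False
  have "dh x (inverse (norm u) *\<^sub>R u) = 0"
    using linear_cmul[OF linear_dh[OF assms(1)]] assms(3) by simp
  then have "c \<le> speed x (inverse (norm u) *\<^sub>R u)" using False by (intro assms(2)) auto
  then show ?thesis using False unfolding speed_scale[OF assms(1)] by (simp add: field_simps)
qed

text \<open>The displacement is the integral of the velocity. A bound of the speed from below up to time
  \<open>\<tau>\<close> therefore bounds the length of the whole curve by the displacement reached at time \<open>\<tau>\<close>.\<close>

lemma length_ge_displacement:
  assumes \<gamma>: "valid_path \<gamma>" "path_image \<gamma> \<subseteq> M"
    and L: "((\<lambda>t. speed (\<gamma> t) (vector_derivative \<gamma> (at t))) has_integral L) {0..1}"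
    and \<tau>: "0 \<le> \<tau>" "\<tau> \<le> 1"
    and c: "c \<ge> 0" "\<And>t u. 0 \<le> t \<Longrightarrow> t \<le> \<tau> \<Longrightarrow> dh (\<gamma> t) u = 0 \<Longrightarrow> c * norm u \<le> speed (\<gamma> t) u"
  shows "c * norm (\<gamma> \<tau> - \<gamma> 0) \<le> L"
proof -
  obtain S where S: "finite S"
    "\<And>t. t \<in> {0..1} - S \<Longrightarrow> (\<gamma> has_vector_derivative vector_derivative \<gamma> (at t)) (at t)"
    using valid_path_derivative[OF \<gamma>(1)] by blast
  (* At parameters without a velocity, and at the end points, where the curve may leave M on the
     other side, the formal velocity need not be tangent, so it is replaced by zero. *)
  define v where "v t = (if t \<in> S \<union> {0, 1} then 0 else vector_derivative \<gamma> (at t))" for t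
  have inM: "\<gamma> t \<in> M" if "t \<in> {0..1}" for t using \<gamma>(2) that by (auto simp: path_image_def)
  have tangent: "dh (\<gamma> t) (v t) = 0" if "t \<in> {0..1}" for t
  proof (cases "t \<in> S \<union> {0, 1}")
    case True
    then show ?thesis using linear_0[OF linear_dh] inM[OF that] M_V by (auto simp: v_def)
  next
    case False
    then show ?thesis
      using that S velocity_tangent[OF M_level \<gamma>(2), of t "v t"] by (auto simp: v_def)
  qed
  let ?f = "\<lambda>t. speed (\<gamma> t) (v t)"
  have f0: "?f t \<ge> 0" if "t \<in> {0..1}" for t
    by (rule speed_nonneg[OF inM[OF that] tangent[OF that]])
  have L': "(?f has_integral L) {0..1}"
    by (rule has_integral_spike_finite[OF _ _ L, of "S \<union> {0, 1}"]) (use S in \<open>auto simp: v_def\<close>)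
  then have int: "?f integrable_on {0..1}" by blast
  then have int\<tau>: "?f integrable_on {0..\<tau>}"
    by (rule integrable_on_subinterval) (use \<tau> in auto)
  have "(v has_integral \<gamma> \<tau> - \<gamma> 0) {0..\<tau>}"
  proof (rule fundamental_theorem_of_calculus_interior_strong[of "S \<union> {0, 1}"])
    show "continuous_on {0..\<tau>} \<gamma>"
      using valid_path_imp_path[OF \<gamma>(1)] \<tau>
      unfolding path_def by (auto intro: continuous_on_subset)
  qed (use S \<tau> in \<open>auto simp: v_def\<close>)
  then have v: "((\<lambda>t. c *\<^sub>R v t) has_integral c *\<^sub>R (\<gamma> \<tau> - \<gamma> 0)) {0..\<tau>}"
    by (rule has_integral_cmul)
  have "c * norm (\<gamma> \<tau> - \<gamma> 0) = norm (integral {0..\<tau>} (\<lambda>t. c *\<^sub>R v t))"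
    unfolding integral_unique[OF v] using c(1) by simp
  also have "... \<le> integral {0..\<tau>} ?f"
    by (rule integral_norm_bound_integral) (use v int\<tau> c tangent \<tau> in auto)
  also have "... \<le> integral {0..1} ?f"
    by (rule integral_subset_le) (use \<tau> int int\<tau> f0 in auto)
  also have "... = L" using integral_unique[OF L'] .
  finally show ?thesis .
qed

lemma length_nonneg:
  assumes "L \<in> lengths p q"
  shows "L \<ge> 0"
proof -
  obtain \<gamma> where \<gamma>: "valid_path \<gamma>" "path_image \<gamma> \<subseteq> M"
    "((\<lambda>t. speed (\<gamma> t) (vector_derivative \<gamma> (at t))) has_integral L) {0..1}"
    using assms unfolding curve_lengths_def by blast
  have "\<gamma> 0 \<in> M" using \<gamma>(2) by (auto simp: path_image_def)
  then have "0 * norm (\<gamma> 0 - \<gamma> 0) \<le> L"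
    using speed_nonneg by (intro length_ge_displacement[OF \<gamma>]) (auto dest: order_antisym)
  then show ?thesis by simp
qed

lemma bdd_below_lengths: "bdd_below (lengths p q)"
  using length_nonneg by (meson bdd_belowI)

text \<open>The projection of a segment has speed at most \<open>C\<close> times the length of the segment, by compactness.
  The point \<open>p\<close> need not belong to \<open>M\<close>, so the bound is uniform up to the boundary of \<open>M\<close>.\<close>

lemma short_chart_curves:
  assumes p: "p \<in> level"
  obtains s C where "s > 0" "C > 0"
    "\<And>x. x \<in> cball p s \<Longrightarrow> x \<in> V \<and> h x > 0 \<and> radial x \<in> level"
    "\<And>a b. a \<in> cball p s \<Longrightarrow> b \<in> cball p s \<Longrightarrow> radial ` closed_segment a b \<subseteq> M \<Longrightarrow>
       \<exists>L\<in>lengths (radial a) (radial b). L \<le> C * dist a b"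
proof -
  obtain s where s: "s > 0" "\<And>x. x \<in> cball p s \<Longrightarrow> x \<in> V \<and> h x > 0 \<and> radial x \<in> level \<inter> UNIV"
    by (rule radial_chart[OF p open_UNIV UNIV_I]) blast
  define F where "F x u = speed (radial x) (dradial x u)" for x u
  have "continuous_on (cball p s \<times> UNIV) (\<lambda>z. radial (fst z))"
    by (rule continuous_on_compose2[OF continuous_radial]) (use s in \<open>auto intro!: continuous_intros\<close>)
  moreover have "cball p s \<times> (UNIV :: (real ^ 'm) set) \<subseteq> {x \<in> V. h x > 0} \<times> UNIV" using s(2) by blast
  from continuous_on_subset[OF continuous_dradial this]
  have "continuous_on (cball p s \<times> UNIV) (\<lambda>z. dradial (fst z) (snd z))"
    by (simp add: case_prod_unfold)
  ultimately have "continuous_on (cball p s \<times> UNIV) (\<lambda>z. (radial (fst z), dradial (fst z) (snd z)))"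
    by (rule continuous_on_Pair)
  then have F: "continuous_on (cball p s \<times> UNIV) (\<lambda>z. F (fst z) (snd z))"
    unfolding F_def
    by (intro continuous_on_real_sqrt
        continuous_on_compose2[OF continuous_g, of _ "\<lambda>z. (radial (fst z), dradial (fst z) (snd z))",
          unfolded case_prod_conv])
       (use s in auto)
  have "compact ((\<lambda>z. F (fst z) (snd z)) ` (cball p s \<times> sphere 0 1))"
    by (intro compact_continuous_image continuous_on_subset[OF F] compact_Times) auto
  then have "bounded ((\<lambda>z. F (fst z) (snd z)) ` (cball p s \<times> sphere 0 1))"
    by (rule compact_imp_bounded)
  then obtain C where C: "C > 0" "\<forall>y\<in>(\<lambda>z. F (fst z) (snd z)) ` (cball p s \<times> sphere 0 1). norm y \<le> C"
    unfolding bounded_pos by blast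
  have F_le_C: "F x u \<le> C" if "x \<in> cball p s" "norm u = 1" for x u
    using bspec[OF C(2), of "F x u"] that by force
  have F_scale: "F x (c *\<^sub>R u) = \<bar>c\<bar> * F x u" if "x \<in> cball p s" for x c u
  proof -
    have "x \<in> V" "radial x \<in> V" using s that by auto
    then show ?thesis
      using speed_scale[OF \<open>radial x \<in> V\<close>] dradial_scaleR[OF \<open>x \<in> V\<close>] by (simp add: F_def)
  qed
  have F_le: "F x u \<le> C * norm u" if "x \<in> cball p s" for x u
  proof (cases "u = 0")
    case True
    then show ?thesis using F_scale[OF that, of 0 u] by simp
  next
    case False
    then show ?thesis
      using F_le_C[OF that, of "inverse (norm u) *\<^sub>R u"]
      unfolding F_scale[OF that] by (simp add: field_simps)
  qed
  have "\<exists>L\<in>lengths (radial a) (radial b). L \<le> C * dist a b"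
    if ab: "a \<in> cball p s" "b \<in> cball p s" and inM: "radial ` closed_segment a b \<subseteq> M" for a b
  proof -
    let ?l = "linepath a b" and ?\<gamma> = "\<lambda>t. radial (linepath a b t)"
    have l: "?l t \<in> cball p s" if "t \<in> {0..1}" for t
      using closed_segment_subset[OF ab convex_cball] linepath_in_path[OF that, of a b] by blast
    have deriv: "(?\<gamma> has_vector_derivative dradial (?l t) (b - a)) (at t)" if "t \<in> {0..1}" for t
    proof -
      have V: "?l t \<in> V" "h (?l t) > 0" using s l[OF that] by auto
      have "(?l has_derivative (\<lambda>r. r *\<^sub>R (b - a))) (at t)"
        using has_vector_derivative_linepath_within[of a b t UNIV] by (simp add: has_vector_derivative_def)
      from has_derivative_compose[OF this has_derivative_radial[OF V]]
      show ?thesis unfolding has_vector_derivative_def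
        by (simp add: dradial_scaleR[OF V(1)])
    qed
    have cl: "continuous_on {0..1} (\<lambda>t. (?l t, b - a))"
      by (intro continuous_intros continuous_on_linepath)
    have "continuous_on {0..1} (\<lambda>t. dradial (?l t) (b - a))"
      by (rule continuous_on_compose2[OF continuous_dradial cl, unfolded case_prod_conv]) (use l s in auto)
    then have "?\<gamma> C1_differentiable_on {0..1}"
      unfolding C1_differentiable_on_def
      by (intro exI[of _ "\<lambda>t. dradial (?l t) (b - a)"] conjI ballI deriv)
    then have "valid_path ?\<gamma>"
      unfolding valid_path_def by (rule C1_differentiable_imp_piecewise)
    moreover have "path_image ?\<gamma> \<subseteq> M"
      using inM linepath_image_01[of a b] by (auto simp: path_image_def)
    moreover have vd: "vector_derivative ?\<gamma> (at t) = dradial (?l t) (b - a)" if "t \<in> {0..1}" for t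
      using vector_derivative_at[OF deriv[OF that]] .
    moreover have cF: "continuous_on {0..1} (\<lambda>t. F (?l t) (b - a))"
      by (rule continuous_on_compose2[OF F cl, unfolded fst_conv snd_conv]) (use l in auto)
    then have "((\<lambda>t. F (?l t) (b - a)) has_integral integral {0..1} (\<lambda>t. F (?l t) (b - a))) {0..1}"
      by (intro integrable_integral integrable_continuous_real)
    then have "((\<lambda>t. speed (?\<gamma> t) (vector_derivative ?\<gamma> (at t)))
        has_integral integral {0..1} (\<lambda>t. F (?l t) (b - a))) {0..1}"
      by (rule has_integral_eq[rotated]) (use vd in \<open>simp add: F_def\<close>)
    moreover have "pathstart ?\<gamma> = radial a" "pathfinish ?\<gamma> = radial b"
      by (simp_all add: pathstart_def pathfinish_def linepath_0' linepath_1')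
    ultimately have "integral {0..1} (\<lambda>t. F (?l t) (b - a)) \<in> lengths (radial a) (radial b)"
      unfolding curve_lengths_def by blast
    moreover have "integral {0..1} (\<lambda>t. F (?l t) (b - a)) \<le> integral {0..1::real} (\<lambda>t. C * norm (b - a))"
      by (intro integral_le integrable_continuous_real cF continuous_intros F_le l)
    ultimately show ?thesis
      by (intro bexI) (auto simp: dist_norm norm_minus_commute)
  qed
  then show thesis using s C(1) by (intro that[of s C]) auto
qed

lemma lengths_join: "L1 \<in> lengths p q \<Longrightarrow> L2 \<in> lengths q r \<Longrightarrow> L1 + L2 \<in> lengths p r"
  using g_scale[where c = 2] M_V by (intro curve_lengths_join) auto

lemma lengths_sym: "lengths p q = lengths q p"
proof -
  have "L \<in> lengths q p" if "L \<in> lengths p q" for L p q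
    by (rule curve_lengths_reverse[OF _ that]) (use g_scale[where c = "-1"] M_V in auto)
  then show ?thesis by blast
qed

lemma near_point_chart:
  assumes "p \<in> M"
  obtains s C where "s > 0" "C > 0"
    "\<And>x. x \<in> M \<Longrightarrow> dist p x < s \<Longrightarrow> \<exists>L\<in>lengths p x. L \<le> C * dist p x"
proof -
  have p: "p \<in> level" using assms M_level by blast
  obtain s1 C where 1: "s1 > 0" "C > 0"
    "\<And>a b. a \<in> cball p s1 \<Longrightarrow> b \<in> cball p s1 \<Longrightarrow> radial ` closed_segment a b \<subseteq> M \<Longrightarrow>
       \<exists>L\<in>lengths (radial a) (radial b). L \<le> C * dist a b"
    by (rule short_chart_curves[OF p]) blast
  obtain s2 where 2: "s2 > 0" "\<And>x. x \<in> cball p s2 \<Longrightarrow> x \<in> V \<and> h x > 0 \<and> radial x \<in> M"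
    by (rule openin_level_cball[OF openin_M assms]) blast
  show thesis
  proof (rule that[of "min s1 s2" C])
    fix x assume x: "x \<in> M" "dist p x < min s1 s2"
    have "closed_segment p x \<subseteq> cball p s2"
      using x 2 by (intro closed_segment_subset) auto
    then have "radial ` closed_segment p x \<subseteq> M" using 2 by blast
    moreover have "radial p = p" "radial x = x" using radial_level p M_level x(1) by blast+
    ultimately show "\<exists>L\<in>lengths p x. L \<le> C * dist p x"
      using 1(3)[of p x] 1(1) x(2) by simp
  qed (use 1 2 in auto)
qed

text \<open>Connectedness by curves of finite length, without which the infimum that defines the distance
  would be an arbitrary number.\<close>

lemma lengths_nonempty:
  assumes "p \<in> M" "q \<in> M"
  shows "lengths p q \<noteq> {}"
proof (rule connected_equivalence_relation[OF connected_M assms])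
  show "lengths y x \<noteq> {}" if "lengths x y \<noteq> {}" for x y using that lengths_sym by simp
  show "lengths x z \<noteq> {}" if "lengths x y \<noteq> {}" "lengths y z \<noteq> {}" for x y z
    using that lengths_join by blast
  fix a assume a: "a \<in> M"
  obtain s C where s: "s > 0" "\<And>x. x \<in> M \<Longrightarrow> dist a x < s \<Longrightarrow> \<exists>L\<in>lengths a x. L \<le> C * dist a x"
    by (rule near_point_chart[OF a]) blast
  have "lengths a x \<noteq> {}" if "x \<in> M \<inter> ball a s" for x using s(2)[of x] that by auto
  then show "\<exists>T. openin (top_of_set M) T \<and> a \<in> T \<and> (\<forall>x\<in>T. lengths a x \<noteq> {})"
    using s a by (intro exI[of _ "M \<inter> ball a s"]) (auto simp: openin_open_Int)
qed

lemma d_le_length: "p \<in> M \<Longrightarrow> q \<in> M \<Longrightarrow> L \<in> lengths p q \<Longrightarrow> d p q \<le> L"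
  by (simp add: riemannian_dist_curve_lengths cInf_lower bdd_below_lengths)

lemma d_greatest:
  assumes "p \<in> M" "q \<in> M" "\<And>L. L \<in> lengths p q \<Longrightarrow> c \<le> L"
  shows "c \<le> d p q"
  using assms by (simp add: riemannian_dist_curve_lengths cInf_greatest lengths_nonempty)

lemma d_locally_le:
  assumes "p \<in> M"
  obtains s C where "s > 0" "C > 0" "\<And>x. x \<in> M \<Longrightarrow> dist p x < s \<Longrightarrow> d p x \<le> C * dist p x"
proof -
  obtain s C where s: "s > 0" "C > 0"
    "\<And>x. x \<in> M \<Longrightarrow> dist p x < s \<Longrightarrow> \<exists>L\<in>lengths p x. L \<le> C * dist p x"
    by (rule near_point_chart[OF assms]) blast
  show thesis
    using s(3) d_le_length[OF assms] by (intro that[OF s(1,2)]) (meson order_trans)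
qed

lemma d_ge_displacement:
  assumes "\<And>x u. x \<in> M \<Longrightarrow> dh x u = 0 \<Longrightarrow> c * norm u \<le> speed x u" "c \<ge> 0" "p \<in> M" "q \<in> M"
  shows "c * dist p q \<le> d p q"
proof (rule d_greatest[OF assms(3,4)])
  fix L assume "L \<in> lengths p q"
  then obtain \<gamma> where \<gamma>: "valid_path \<gamma>" "path_image \<gamma> \<subseteq> M" "pathstart \<gamma> = p" "pathfinish \<gamma> = q"
    "((\<lambda>t. speed (\<gamma> t) (vector_derivative \<gamma> (at t))) has_integral L) {0..1}"
    unfolding curve_lengths_def by blast
  have "\<gamma> t \<in> M" if "0 \<le> t" "t \<le> 1" for t using \<gamma>(2) that by (auto simp: path_image_def)
  then have "c * norm (\<gamma> 1 - \<gamma> 0) \<le> L"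
    using assms by (intro length_ge_displacement[OF \<gamma>(1,2,5)]) auto
  then show "c * dist p q \<le> L"
    using \<gamma>(3,4) by (simp add: pathstart_def pathfinish_def dist_norm norm_minus_commute)
qed

text \<open>On the compact set of unit tangent vectors at points near \<open>p\<close> the speed is at least some
  \<open>c > 0\<close>. A curve from \<open>p\<close> to \<open>q\<close> either stays near \<open>p\<close> or travels at least the distance \<open>r\<close>
  before it leaves. Hence the topology of the Riemannian distance is at least as fine as the
  Euclidean one.\<close>

lemma d_locally_ge:
  assumes p: "p \<in> M"
  obtains r c where "r > 0" "c > 0" "\<And>q. q \<in> M \<Longrightarrow> c * min r (dist p q) \<le> d p q"
proof -
  obtain r where r: "r > 0" "level \<inter> cball p r \<subseteq> M"
    "\<And>x. x \<in> cball p r \<Longrightarrow> x \<in> V \<and> h x > 0 \<and> radial x \<in> M"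
    by (rule openin_level_cball[OF openin_M p]) blast
  let ?B = "cball p r \<times> sphere 0 1 :: ((real ^ 'm) \<times> (real ^ 'm)) set"
  have BV: "?B \<subseteq> V \<times> UNIV" using r by auto
  have "compact ({z \<in> ?B. h (fst z) = 1} \<inter> {z \<in> ?B. dh (fst z) (snd z) = 0})"
  proof (intro compact_Int_closed closed_Int)
    have B: "compact ?B" by (intro compact_Times) auto
    have "continuous_on ?B (\<lambda>z. h (fst z))"
      by (rule continuous_on_compose2[OF continuous_h]) (use r in \<open>auto intro!: continuous_intros\<close>)
    from compact_Int_closed[OF B continuous_closed_preimage_constant[OF this compact_imp_closed[OF B], of 1]]
    show "compact {z \<in> ?B. h (fst z) = 1}" by (simp add: Int_absorb1 Collect_restrict)
    have "continuous_on ?B (\<lambda>z. dh (fst z) (snd z))"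
      using continuous_on_subset[OF continuous_dh BV] by (simp add: case_prod_unfold)
    from continuous_closed_preimage_constant[OF this compact_imp_closed[OF B], of 0]
    show "closed {z \<in> ?B. dh (fst z) (snd z) = 0}" .
  qed
  moreover have "{z \<in> ?B. h (fst z) = 1} \<inter> {z \<in> ?B. dh (fst z) (snd z) = 0}
     = {z \<in> ?B. h (fst z) = 1 \<and> dh (fst z) (snd z) = 0}" (is "_ = ?K") by blast
  ultimately have K: "compact ?K" by simp
  have "\<exists>c>0. \<forall>z\<in>?K. c \<le> speed (fst z) (snd z)"
  proof (cases "?K = {}")
    case False
    have "continuous_on ?K (\<lambda>z. speed (fst z) (snd z))"
      using continuous_on_subset[OF continuous_g, of ?K] BV
      by (intro continuous_on_real_sqrt) (auto simp: case_prod_unfold)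
    from continuous_attains_inf[OF K False this] obtain z where z: "z \<in> ?K"
      "\<forall>y\<in>?K. speed (fst z) (snd z) \<le> speed (fst y) (snd y)" by blast
    have "fst z \<in> M" using z(1) r by auto
    then have "speed (fst z) (snd z) > 0" using z(1) g_pos[of "fst z" "snd z"] by fastforce
    then show ?thesis using z(2) by blast
  qed (use zero_less_one in blast)
  then obtain c where c: "c > 0" "\<forall>z\<in>?K. c \<le> speed (fst z) (snd z)" by blast
  have speed: "c * norm u \<le> speed x u" if "x \<in> M" "dist p x \<le> r" "dh x u = 0" for x u
  proof (rule speed_bound_from_unit[OF _ _ that(3)])
    show "c \<le> speed x u" if "norm u = 1" "dh x u = 0" for u
      using bspec[OF c(2), of "(x, u)"] that \<open>x \<in> M\<close> \<open>dist p x \<le> r\<close> M_level by auto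
  qed (use that M_V in auto)
  show thesis
  proof (rule that[OF r(1) c(1)], rule d_greatest[OF p], assumption)
    fix q L assume "q \<in> M" "L \<in> lengths p q"
    then obtain \<gamma> where \<gamma>: "valid_path \<gamma>" "path_image \<gamma> \<subseteq> M" "pathstart \<gamma> = p" "pathfinish \<gamma> = q"
      "((\<lambda>t. speed (\<gamma> t) (vector_derivative \<gamma> (at t))) has_integral L) {0..1}"
      unfolding curve_lengths_def by blast
    let ?m = "min r (dist p q)" and ?f = "\<lambda>t. dist p (\<gamma> t)"
    have \<gamma>01: "\<gamma> 0 = p" "\<gamma> 1 = q" using \<gamma>(3,4) by (simp_all add: pathstart_def pathfinish_def)
    have cf: "continuous_on {0..1} ?f"
      using valid_path_imp_path[OF \<gamma>(1)] unfolding path_def by (intro continuous_intros)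
    let ?T = "{t \<in> {0..1}. ?f t = ?m}"
    have hit: "\<exists>t\<ge>0. t \<le> b \<and> ?f t = ?m" if "0 \<le> b" "b \<le> 1" "?m \<le> ?f b" for b
      using that r(1) \<gamma>01 by (intro IVT'[of ?f 0 ?m b] continuous_on_subset[OF cf]) auto
    have "compact ?T"
      using continuous_closed_preimage_constant[OF cf closed_atLeastAtMost, of ?m]
      by (auto simp: compact_eq_bounded_closed intro: bounded_subset[of "{0..1::real}"])
    moreover have "?T \<noteq> {}" using hit[of 1] \<gamma>01 by auto
    (* the first time at which the curve reaches distance ?m from p *)
    ultimately obtain \<tau> where \<tau>: "\<tau> \<in> ?T" "\<forall>t\<in>?T. \<tau> \<le> t" using compact_attains_inf by blast
    have near: "?f t \<le> r" if t: "0 \<le> t" "t \<le> \<tau>" for t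
    proof (rule ccontr)
      assume *: "\<not> ?f t \<le> r"
      then have "?m \<le> ?f t" by simp
      then obtain t' where "t' \<ge> 0" "t' \<le> t" "?f t' = ?m" using hit[of t] t \<tau>(1) by auto
      moreover from this have "\<tau> \<le> t'" using \<tau> t by simp
      ultimately have "t' = t" using t by simp
      then show False using * \<open>?f t' = ?m\<close> by auto
    qed
    have "c * norm (\<gamma> \<tau> - \<gamma> 0) \<le> L"
    proof (rule length_ge_displacement[OF \<gamma>(1,2,5)])
      show "c * norm u \<le> speed (\<gamma> t) u" if "0 \<le> t" "t \<le> \<tau>" "dh (\<gamma> t) u = 0" for t u
        using that \<gamma>(2) \<tau>(1) near by (intro speed) (auto simp: path_image_def)
    qed (use c \<tau> in auto)
    then show "c * ?m \<le> L"
      using \<tau>(1) \<gamma>01 by (simp add: dist_norm norm_minus_commute)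
  qed
qed

lemma Metric_space_d: "Metric_space M d"
proof
  show "0 \<le> d x y" for x y
    by (cases "x \<in> M \<and> y \<in> M") (use d_greatest length_nonneg in \<open>auto simp: riemannian_dist_def\<close>)
  show "d x y = d y x" for x y
    by (cases "x \<in> M \<and> y \<in> M")
      (use lengths_sym in \<open>auto simp: riemannian_dist_curve_lengths, auto simp: riemannian_dist_def\<close>)
  show "d x y = 0 \<longleftrightarrow> x = y" if xy: "x \<in> M" "y \<in> M" for x y
  proof
    assume "d x y = 0"
    obtain r c where r: "r > 0" "c > 0" "\<And>q. q \<in> M \<Longrightarrow> c * min r (dist x q) \<le> d x q"
      by (rule d_locally_ge[OF xy(1)]) blast
    then show "x = y" using \<open>d x y = 0\<close> r(1,2) r(3)[OF xy(2)]
      by (auto simp: mult_le_0_iff min_le_iff_disj)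
  next
    assume "x = y"
    have "0 \<in> lengths x x"
      using that g_scale[of x 0 0] M_V by (intro curve_lengths_refl) auto
    then show "d x y = 0"
      using \<open>x = y\<close> that d_le_length[of x x 0] d_greatest[of x x 0] length_nonneg by force
  qed
  show "d x z \<le> d x y + d y z" if "x \<in> M" "y \<in> M" "z \<in> M" for x y z
  proof -
    have "d x z - L2 \<le> d x y" if "L2 \<in> lengths y z" for L2
      using d_le_length[OF \<open>x \<in> M\<close> \<open>z \<in> M\<close> lengths_join[OF _ that]]
      by (intro d_greatest[OF \<open>x \<in> M\<close> \<open>y \<in> M\<close>]) (simp add: algebra_simps)
    then have "d x z - d x y \<le> d y z"
      by (intro d_greatest[OF that(2,3)]) (simp add: algebra_simps)
    then show ?thesis by simp
  qed
qed

text \<open>A limit point \<open>p\<close> of \<open>M\<close> outside \<open>M\<close> still satisfies \<open>h p = 1\<close>. The projection of a short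
  segment that ends in \<open>p\<close> starts in \<open>M\<close> and has bounded speed, so up to its first exit from \<open>M\<close>
  it yields a Cauchy sequence. The Euclidean limit of this sequence is the exit point, which is not
  in \<open>M\<close>; but by \<open>d_locally_ge\<close> a limit in the Riemannian distance would have to agree with it.\<close>

theorem complete_imp_closed:
  assumes complete: "riemannian_complete M g" and "closure M \<subseteq> V"
  shows "closed M"
proof (rule ccontr)
  interpret d: Metric_space M d by (rule Metric_space_d)
  assume "\<not> closed M"
  then obtain p where p: "p \<in> closure M" "p \<notin> M"
    using closure_subset_eq by blast
  have "h p = 1"
    using continuous_constant_on_closure[of M h 1 p] continuous_on_subset[OF continuous_h assms(2)]
      M_level p(1) by blast
  then have "p \<in> level" using p(1) assms(2) by blast
  then obtain s C where s: "s > 0" and C: "C > 0"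
    and chart: "\<And>x. x \<in> cball p s \<Longrightarrow> x \<in> V \<and> h x > 0 \<and> radial x \<in> level"
    and short: "\<And>a b. a \<in> cball p s \<Longrightarrow> b \<in> cball p s \<Longrightarrow> radial ` closed_segment a b \<subseteq> M \<Longrightarrow>
       \<exists>L\<in>lengths (radial a) (radial b). L \<le> C * dist a b"
    by (rule short_chart_curves) blast
  obtain q where q: "q \<in> M" "dist q p < s" using p(1) s closure_approachable by blast
  let ?l = "linepath q p"
  have l: "?l t \<in> cball p s" if "t \<in> {0..1}" for t
    using closed_segment_subset[OF _ _ convex_cball, of q p s p] linepath_in_path[OF that, of q p] q s
    by (auto simp: dist_commute)
  define \<eta> where "\<eta> t = radial (?l t)" for t
  have \<eta>: "continuous_on {0..1} \<eta>" unfolding \<eta>_def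
    by (rule continuous_on_compose2[OF continuous_radial continuous_on_linepath]) (use l chart in auto)
  have "openin (top_of_set {0..1}) ({0..1} \<inter> \<eta> -` M)"
    by (rule continuous_openin_preimage[OF \<eta> _ openin_M]) (use l chart in \<open>auto simp: \<eta>_def\<close>)
  then have "closedin (top_of_set {0..1}) ({0..1} - ({0..1} \<inter> \<eta> -` M))"
    by (simp add: closedin_def double_diff)
  then have outside: "compact ({0..1} - ({0..1} \<inter> \<eta> -` M))"
    using closedin_compact compact_Icc by blast
  have "\<eta> 1 = p" "\<eta> 0 = q"
    using radial_level \<open>p \<in> level\<close> q M_level by (auto simp: \<eta>_def linepath_0' linepath_1')
  then have "1 \<in> {0..1} - ({0..1} \<inter> \<eta> -` M)" using p by auto
  then obtain \<tau> where \<tau>: "\<tau> \<in> {0..1}" "\<eta> \<tau> \<notin> M"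
    "\<forall>t\<in>{0..1} - ({0..1} \<inter> \<eta> -` M). \<tau> \<le> t"
    using compact_attains_inf[OF outside] by blast
  have below: "\<eta> t \<in> M" if "0 \<le> t" "t < \<tau>" for t using \<tau> that by force
  have "\<tau> > 0" using \<tau> \<open>\<eta> 0 = q\<close> q by (cases "\<tau> = 0") auto
  (* parameters that increase to the exit time without reaching it *)
  define T where "T n = \<tau> * (1 - inverse (real (Suc n)))" for n
  have T: "0 \<le> T n" "T n < \<tau>" for n using \<open>\<tau> > 0\<close> by (auto simp: T_def field_simps)
  have "T \<longlonglongrightarrow> \<tau> * (1 - 0)"
    unfolding T_def by (intro tendsto_intros LIMSEQ_inverse_real_of_nat)
  then have T_lim: "T \<longlonglongrightarrow> \<tau>" by simp
  have d_T: "d (\<eta> (T m)) (\<eta> (T n)) \<le> C * (dist (T m) (T n) * dist q p)" for m n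
  proof -
    have T01: "T i \<in> {0..1}" for i using T[of i] \<tau>(1) by auto
    have "closed_segment (?l (T m)) (?l (T n)) \<subseteq> ?l ` closed_segment (T m) (T n)"
    proof
      fix y assume "y \<in> closed_segment (?l (T m)) (?l (T n))"
      then obtain u where u: "0 \<le> u" "u \<le> 1" "y = (1 - u) *\<^sub>R ?l (T m) + u *\<^sub>R ?l (T n)"
        by (auto simp: in_segment)
      then have "y = ?l ((1 - u) *\<^sub>R T m + u *\<^sub>R T n)"
        by (simp add: linepath_def algebra_simps)
      then show "y \<in> ?l ` closed_segment (T m) (T n)"
        using u by (intro image_eqI) (auto simp: in_segment)
    qed
    moreover have "\<eta> t \<in> M" if "t \<in> closed_segment (T m) (T n)" for t
      using that T[of m] T[of n] by (intro below) (auto simp: closed_segment_eq_real_ivl split: if_splits)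
    ultimately have "radial ` closed_segment (?l (T m)) (?l (T n)) \<subseteq> M"
      unfolding \<eta>_def by blast
    from short[OF l[OF T01] l[OF T01] this]
    have "d (\<eta> (T m)) (\<eta> (T n)) \<le> C * dist (?l (T m)) (?l (T n))"
      using d_le_length below[OF T] unfolding \<eta>_def by (meson order_trans)
    moreover have "dist (?l (T m)) (?l (T n)) = dist (T m) (T n) * dist q p"
    proof -
      have "?l (T m) - ?l (T n) = (T m - T n) *\<^sub>R (p - q)"
        by (simp add: linepath_def algebra_simps)
      then show ?thesis by (simp add: dist_norm norm_minus_commute)
    qed
    ultimately show ?thesis by simp
  qed
  have "d.MCauchy (\<lambda>n. \<eta> (T n))"
    unfolding d.MCauchy_def
  proof (intro conjI allI impI)
    show "range (\<lambda>n. \<eta> (T n)) \<subseteq> M" using below[OF T] by blast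
    fix e :: real assume "e > 0"
    let ?D = "C * (dist q p + 1)"
    have D: "?D > 0" using C by (simp add: add_nonneg_pos)
    obtain N where N: "\<And>m n. N \<le> m \<Longrightarrow> N \<le> n \<Longrightarrow> dist (T m) (T n) < e / ?D"
      using LIMSEQ_imp_Cauchy[OF T_lim] \<open>e > 0\<close> D unfolding Cauchy_def
      by (meson divide_pos_pos)
    have "d (\<eta> (T m)) (\<eta> (T n)) < e" if "N \<le> m" "N \<le> n" for m n
    proof -
      have "C * (dist (T m) (T n) * dist q p) \<le> dist (T m) (T n) * ?D"
        using C by (simp add: algebra_simps)
      also have "... < e" using N[OF that] D by (simp add: pos_less_divide_eq)
      finally show ?thesis using d_T[of m n] by simp
    qed
    then show "\<exists>N. \<forall>n n'. N \<le> n \<longrightarrow> N \<le> n' \<longrightarrow> d (\<eta> (T n)) (\<eta> (T n')) < e" by blast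
  qed
  then obtain x where "limitin d.mtopology (\<lambda>n. \<eta> (T n)) x sequentially"
    using complete unfolding riemannian_complete_def d.mcomplete_def by blast
  then have x: "x \<in> M" "\<And>e. e > 0 \<Longrightarrow> \<exists>N. \<forall>n\<ge>N. d (\<eta> (T n)) x < e"
    unfolding d.limit_metric_sequentially by meson+
  obtain r c where r: "r > 0" "c > 0" "\<And>y. y \<in> M \<Longrightarrow> c * min r (dist x y) \<le> d x y"
    by (rule d_locally_ge[OF x(1)]) blast
  have "(\<lambda>n. \<eta> (T n)) \<longlonglongrightarrow> x"
    unfolding lim_sequentially
  proof (intro allI impI)
    fix e :: real assume "e > 0"
    then obtain N where N: "\<And>n. n \<ge> N \<Longrightarrow> d (\<eta> (T n)) x < c * min r e"
      using x(2)[of "c * min r e"] r by auto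
    have "dist (\<eta> (T n)) x < e" if "n \<ge> N" for n
    proof -
      have "c * min r (dist x (\<eta> (T n))) < c * min r e"
        using N[OF that] r(3)[OF below[OF T]] d.commute[of x] by (metis order_le_less_trans)
      then show ?thesis using r(2) by (auto simp: dist_commute min_def split: if_splits)
    qed
    then show "\<exists>N. \<forall>n\<ge>N. dist (\<eta> (T n)) x < e" by blast
  qed
  moreover have "(\<lambda>n. \<eta> (T n)) \<longlonglongrightarrow> \<eta> \<tau>"
  proof (rule continuous_on_tendsto_compose[OF \<eta> T_lim \<tau>(1)])
    have "T n \<in> {0..1}" for n using T[of n] \<tau>(1) by auto
    then show "\<forall>\<^sub>F n in sequentially. T n \<in> {0..1}" by simp
  qed
  ultimately have "\<eta> \<tau> = x" using LIMSEQ_unique by blast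
  then show False using \<tau>(2) x(1) by simp
qed

text \<open>If the metric dominates the Euclidean one, a Cauchy sequence converges in the Euclidean sense,
  to a point of \<open>M\<close> by closedness. Near this point the Riemannian distance is at most a multiple
  of the Euclidean one, so the convergence is Riemannian as well.\<close>

theorem closed_imp_complete:
  assumes "closed M" and "\<And>x u. x \<in> M \<Longrightarrow> dh x u = 0 \<Longrightarrow> norm u \<le> speed x u"
  shows "riemannian_complete M g"
proof -
  interpret d: Metric_space M d by (rule Metric_space_d)
  have "\<exists>x. limitin d.mtopology \<sigma> x sequentially" if Cauchy: "d.MCauchy \<sigma>" for \<sigma>
  proof -
    have \<sigma>: "\<sigma> n \<in> M" for n using Cauchy unfolding d.MCauchy_def by blast
    have dist_le: "dist (\<sigma> m) (\<sigma> n) \<le> d (\<sigma> m) (\<sigma> n)" for m n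
      using d_ge_displacement[of 1 "\<sigma> m" "\<sigma> n"] assms(2) \<sigma> by simp
    have "Cauchy \<sigma>"
      unfolding Cauchy_def
    proof (intro allI impI)
      fix e :: real assume "e > 0"
      then obtain N where "\<And>m n. N \<le> m \<Longrightarrow> N \<le> n \<Longrightarrow> d (\<sigma> m) (\<sigma> n) < e"
        using Cauchy unfolding d.MCauchy_def by blast
      then show "\<exists>N. \<forall>m\<ge>N. \<forall>n\<ge>N. dist (\<sigma> m) (\<sigma> n) < e"
        using dist_le order_le_less_trans by blast
    qed
    then obtain x where x: "\<sigma> \<longlonglongrightarrow> x" using Cauchy_convergent convergent_def by blast
    then have "x \<in> M" using closed_sequentially[OF assms(1)] \<sigma> by blast
    then obtain s C where s: "s > 0" "C > 0" "\<And>y. y \<in> M \<Longrightarrow> dist x y < s \<Longrightarrow> d x y \<le> C * dist x y"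
      by (rule d_locally_le) blast
    have "limitin d.mtopology \<sigma> x sequentially"
      unfolding d.limit_metric_sequentially
    proof (intro conjI allI impI)
      fix e :: real assume "e > 0"
      then obtain N where N: "\<And>n. n \<ge> N \<Longrightarrow> dist (\<sigma> n) x < min s (e / C)"
        using x s unfolding lim_sequentially by (metis divide_pos_pos min_less_iff_conj)
      have "d (\<sigma> n) x < e" if "n \<ge> N" for n
      proof -
        have "d x (\<sigma> n) \<le> C * dist x (\<sigma> n)"
          using N[OF that] by (intro s(3)[OF \<sigma>]) (simp add: dist_commute)
        also have "... < e" using N[OF that] s(2) by (simp add: field_simps dist_commute)
        finally show ?thesis by (simp add: d.commute)
      qed
      then show "\<exists>N. \<forall>n\<ge>N. \<sigma> n \<in> M \<and> d (\<sigma> n) x < e" using \<sigma> by blast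
    qed fact
    then show ?thesis by blast
  qed
  then show ?thesis unfolding riemannian_complete_def d.mcomplete_def by blast
qed

end

section \<open>Closedness and completeness of the components\<close>

theorem proposition1p8:
  fixes n :: nat and k :: real
    and h :: "real ^ 'm \<Rightarrow> real"
    and U V H H0 :: "(real ^ 'm) set"
  assumes "n \<ge> 1" and "CARD('m) = n + 1"
    and "open V" and "smooth_on h V"
    and "k \<noteq> 0" and "homogeneous_on h k V"
    and "open U" and "U \<subseteq> V"
    and "H = {x \<in> U. h x = 1}" and "closure H \<subseteq> V"
    and "definite_on H (centroaffine_metric H)"
    and "H0 \<in> components H"
  shows "(definite_complete H0 (centroaffine_metric H) \<longrightarrow> closed H0) \<and>
         (closed H0 \<longleftrightarrow> euclidean_complete H0)"
proof -
  interpret homogeneous_function h k V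
    using assms by unfold_locales
  have H: "openin (top_of_set level) H"
    using assms(7,8,9) by (auto simp: openin_open intro!: exI[of _ U])
  have H0: "openin (top_of_set level) H0" by (rule component_openin_level[OF H assms(12)])
  have "connected H0" and sub: "H0 \<subseteq> H"
    using assms(12) in_components_connected in_components_subset by blast+
  have HL: "H0 \<subseteq> level" using H0 openin_imp_subset by blast
  have clV: "closure H0 \<subseteq> V" using closure_mono[OF sub] assms(10) by blast
  have metric_eq: "centroaffine_metric H p u u = - hess p u u / k" if "p \<in> H0" "dh p u = 0" for p u
    using centroaffine_metric_eq_hess[OF H] sub that by blast
  have tangent: "tangent_space H0 p = {v. dh p v = 0}" if "p \<in> H0" for p
    by (rule tangent_space_level[OF H0 that])

  (* The sign epsilon turns a definite centroaffine metric into a positive definite one. *)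
  have closed_if_complete: "closed H0"
    if complete: "riemannian_complete H0 (\<lambda>p u v. \<epsilon> * centroaffine_metric H p u v)"
      and pos: "\<And>p v. p \<in> H0 \<Longrightarrow> v \<in> tangent_space H0 p \<Longrightarrow> v \<noteq> 0 \<Longrightarrow> \<epsilon> * centroaffine_metric H p v v > 0"
    for \<epsilon>
  proof -
    let ?g = "\<lambda>p u v. \<epsilon> * (- hess p u v / k)"
    interpret level_metric h k V H0 ?g
    proof unfold_locales
      show "continuous_on (V \<times> UNIV) (\<lambda>(x, u). \<epsilon> * (- hess x u u / k))"
        using continuous_hess k_nonzero unfolding case_prod_unfold
        by (intro continuous_intros) auto
      show "\<epsilon> * (- hess x u u / k) > 0" if "x \<in> H0" "dh x u = 0" "u \<noteq> 0" for x u
        using pos[OF that(1) _ that(3)] tangent[OF that(1)] that(2) metric_eq[OF that(1,2)] by simp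
    qed (use H0 \<open>connected H0\<close> hess_scaleR in auto)
    have "riemannian_dist H0 ?g = riemannian_dist H0 (\<lambda>p u v. \<epsilon> * centroaffine_metric H p u v)"
      using metric_eq by (intro riemannian_dist_cong_tangent[OF HL]) simp
    then show ?thesis
      using complete clV by (intro complete_imp_closed) (simp_all add: riemannian_complete_def)
  qed
  have "closed H0" if "definite_complete H0 (centroaffine_metric H)"
    using that unfolding definite_complete_def pos_definite_at_def neg_definite_at_def
    using closed_if_complete[of 1] closed_if_complete[of "-1"] by auto
  moreover
  interpret euclidean: level_metric h k V H0 "\<lambda>p u v. u \<bullet> v"
  proof unfold_locales
    show "continuous_on (V \<times> UNIV) (\<lambda>(x, u). u \<bullet> u)"
      unfolding case_prod_unfold by (intro continuous_intros)
  qed (use H0 \<open>connected H0\<close> in \<open>auto simp: power2_eq_square\<close>)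
  have "closed H0 \<longleftrightarrow> euclidean_complete H0"
    unfolding euclidean_complete_def
    using euclidean.complete_imp_closed[OF _ clV] euclidean.closed_imp_complete
    by (auto simp: norm_eq_sqrt_inner)
  ultimately show ?thesis by blast
qed

end
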